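(* Let $\Delta$ be a $(d-1)$-dimensional simplicial complex on $v$ vertices and let $\mathbf k$ be a field of positive prime characteristic $p$. Let $R=\mathbf k[\Delta]$ be the Stanley-Reisner ring of $\Delta$, let $\mathfrak m$ be its unique maximal homogeneous ideal, and let $I_1,\dots,I_g$ be ideals of $R$, each generated by a linear system of parameters of $R$. Let $h(\Delta)=(h_0,h_1,\dots,h_d)$ be the $h$-vector of $R$ and put $\mathbf h(\lambda)=h_0+h_1\lambda+\cdots+h_d\lambda^d$. Let $s_1,\dots,s_g$ be positive integers with $s_1+\cdots+s_g=n+1$. Then $$\ell\left(\frac{R}{(I_1^{s_1}I_2^{s_2}\cdots I_g^{s_g})^*}\right)=\ell\left(\frac{R}{\mathfrak m^{n+1}}\right)=\sum_{i=0}^d(-1)^i\frac{\mathbf h^{(i)}(1)}{i!}\binom{n+d-i}{d-i}.$$ In particular, $e_d^*(I_1^{s_1}I_2^{s_2}\cdots I_g^{s_g})=h_d$ for any positive integers $s_1,\dots,s_g$.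
   Context: $\mathbf k[\Delta]=\mathbf k[X_1,\dots,X_v]/I_\Delta$ with $I_\Delta$ the Stanley-Reisner ideal; it has dimension $d$. The $h$-vector is defined by the Hilbert series $\sum_{j\ge 0}\dim_{\mathbf k}(R_j)\lambda^j=\mathbf h(\lambda)/(1-\lambda)^d$. $\mathbf h^{(i)}$ denotes the $i$-th derivative of $\mathbf h$ with respect to $\lambda$, and the quotient $\mathbf h^{(i)}(1)/i!$ is an integer. A linear system of parameters is a (homogeneous) system of parameters of $\mathbf k[\Delta]$ consisting of linear forms. $\ell$ denotes length. $J^*$ denotes the tight closure of an ideal $J$: $x\in J^*$ iff there is $c\in R$, not in any minimal prime of $R$, with $cx^q\in J^{[q]}$ for all sufficiently large $q=p^e$, where $J^{[q]}$ is generated by the $q$-th powers of elements of $J$. For an $\mathfrak m$-primary ideal $I$ of this kind, $\ell(R/(I^n)^* )$ agrees for all large $n$ with a polynomial $P_I^*(n)=e_0^*(I)\binom{n+d-1}{d}-e_1^*(I)\binom{n+d-2}{d-1}+\cdots+(-1)^d e_d^*(I)$; this defines $e_d^*(I)$. *)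

theory Defs
  imports
    "HOL-Algebra.Module"
    "HOL-Algebra.QuotRing"
    "HOL-Algebra.Ideal_Product"
    "HOL-Algebra.Embedded_Algebras"
    "HOL-Computational_Algebra.Polynomial_FPS"
    "HOL-Computational_Algebra.Primes"
    "HOL-Library.Poly_Mapping"
    "HOL-Library.Extended_Real"
begin

section \<open>Commutative algebra\<close>

text \<open>
  Krull dimension and length are suprema of lengths of strictly increasing chains, of prime ideals
  and of submodules respectively. Products and powers of ideals are those of the monoid \<^const>\<open>ideals_set\<close>, whose
  multiplication is the product of ideals and whose unit is the whole ring.
\<close>

definition minimal_prime :: "'a set \<Rightarrow> ('a, 'b) ring_scheme \<Rightarrow> bool" where
  "minimal_prime P R \<longleftrightarrow>
     primeideal P R \<and> (\<forall>Q. primeideal Q R \<and> Q \<subseteq> P \<longrightarrow> Q = P)"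

definition krull_dim :: "('a, 'b) ring_scheme \<Rightarrow> enat" where
  "krull_dim R =
     Sup {enat n | n. \<exists>P. (\<forall>i\<le>n. primeideal (P i) R) \<and> (\<forall>i<n. P i \<subset> P (Suc i))}"

definition module_length :: "('a, 'c) ring_scheme \<Rightarrow> ('a, 'b, 'd) module_scheme \<Rightarrow> enat" where
  "module_length R M =
     Sup {enat n | n. \<exists>N. (\<forall>i\<le>n. submodule (N i) R M) \<and> (\<forall>i<n. N i \<subset> N (Suc i))}"

definition quotient_module :: "('a, 'b) ring_scheme \<Rightarrow> 'a set \<Rightarrow> ('a, 'a set) module" where
  "quotient_module R J =
     \<lparr>carrier = carrier (R Quot J), monoid.mult = (\<otimes>\<^bsub>R Quot J\<^esub>),
      one = \<one>\<^bsub>R Quot J\<^esub>, zero = \<zero>\<^bsub>R Quot J\<^esub>, add = (\<oplus>\<^bsub>R Quot J\<^esub>),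
      module.smult = (\<lambda>r A. (J +>\<^bsub>R\<^esub> r) \<otimes>\<^bsub>R Quot J\<^esub> A)\<rparr>"

definition quotient_length :: "('a, 'b) ring_scheme \<Rightarrow> 'a set \<Rightarrow> enat" where
  "quotient_length R J = module_length R (quotient_module R J)"

definition frobenius_power :: "('a, 'b) ring_scheme \<Rightarrow> 'a set \<Rightarrow> nat \<Rightarrow> 'a set" where
  "frobenius_power R J q = Idl\<^bsub>R\<^esub> ((\<lambda>y. y [^]\<^bsub>R\<^esub> q) ` J)"

definition tight_closure :: "('a, 'b) ring_scheme \<Rightarrow> nat \<Rightarrow> 'a set \<Rightarrow> 'a set" where
  "tight_closure R p J =
     {x \<in> carrier R. \<exists>c \<in> carrier R. (\<forall>P. minimal_prime P R \<longrightarrow> c \<notin> P) \<and>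
        (\<forall>\<^sub>F e in sequentially. c \<otimes>\<^bsub>R\<^esub> x [^]\<^bsub>R\<^esub> (p ^ e) \<in> frobenius_power R J (p ^ e))}"

text \<open>
  The coefficients $e_0^*(J),\dots,e_d^*(J)$ of the tight Hilbert polynomial of $J$ in a ring of
  dimension $d$, extended by zero beyond index $d$ so that the sequence is unique. Only large $n$ matter, so the
  subtractions on natural numbers do not truncate.
\<close>

definition tight_hilbert_coeff :: "('a, 'b) ring_scheme \<Rightarrow> nat \<Rightarrow> nat \<Rightarrow> 'a set \<Rightarrow> nat \<Rightarrow> real" where
  "tight_hilbert_coeff R p d J = (THE e. (\<forall>i>d. e i = 0) \<and>
     (\<forall>\<^sub>F n in sequentially.
        ereal_of_enat (quotient_length R (tight_closure R p (J [^]\<^bsub>ideals_set R\<^esub> n))) =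
        ereal (\<Sum>i\<le>d. (-1) ^ i * e i * real ((n + d - 1 - i) choose (d - i)))))"


section \<open>Graded algebras\<close>

text \<open>
  A graded algebra is given by a ring \<open>R\<close>, its subfield \<open>K\<close> of scalars, and its
  homogeneous components \<open>gr 0\<close>, \<open>gr 1\<close>, \<dots>.
\<close>

definition hilbert_series :: "('a, 'b) ring_scheme \<Rightarrow> 'a set \<Rightarrow> (nat \<Rightarrow> 'a set) \<Rightarrow> real fps" where
  "hilbert_series R K gr = Abs_fps (\<lambda>j. real (ring.dim R K (gr j)))"

definition h_polynomial :: "('a, 'b) ring_scheme \<Rightarrow> 'a set \<Rightarrow> (nat \<Rightarrow> 'a set) \<Rightarrow> nat \<Rightarrow> real poly" where
  "h_polynomial R K gr d = (THE h. Polynomial.degree h \<le> d \<and>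
     hilbert_series R K gr = fps_of_poly h / (1 - fps_X) ^ d)"

definition homogeneous_ideal :: "'a set \<Rightarrow> ('a, 'b) ring_scheme \<Rightarrow> (nat \<Rightarrow> 'a set) \<Rightarrow> bool" where
  "homogeneous_ideal J R gr \<longleftrightarrow> ideal J R \<and> J = Idl\<^bsub>R\<^esub> (J \<inter> (\<Union>j. gr j))"

definition maximal_homogeneous_ideal :: "'a set \<Rightarrow> ('a, 'b) ring_scheme \<Rightarrow> (nat \<Rightarrow> 'a set) \<Rightarrow> bool" where
  "maximal_homogeneous_ideal M R gr \<longleftrightarrow>
     homogeneous_ideal M R gr \<and> M \<noteq> carrier R \<and>
     (\<forall>J. homogeneous_ideal J R gr \<and> M \<subseteq> J \<longrightarrow> J = M \<or> J = carrier R)"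

text \<open>
  A homogeneous system of parameters consists of $\dim R$ homogeneous elements of positive degree
  modulo which \<open>R\<close> has finite length; it is linear if all of them have degree one.
\<close>

definition linear_sop :: "('a, 'b) ring_scheme \<Rightarrow> (nat \<Rightarrow> 'a set) \<Rightarrow> 'a list \<Rightarrow> bool" where
  "linear_sop R gr \<theta> \<longleftrightarrow>
     set \<theta> \<subseteq> gr 1 \<and> enat (length \<theta>) = krull_dim R \<and>
     quotient_length R (Idl\<^bsub>R\<^esub> (set \<theta>)) < \<infinity>"


section \<open>Simplicial complexes and Stanley-Reisner rings\<close>

definition simplicial_complex :: "nat \<Rightarrow> nat set set \<Rightarrow> bool" where
  "simplicial_complex v \<Delta> \<longleftrightarrow>
     \<Delta> \<subseteq> Pow {1..v} \<and> {} \<in> \<Delta> \<and> (\<forall>F\<in>\<Delta>. \<forall>G\<subseteq>F. G \<in> \<Delta>) \<and> (\<forall>i\<in>{1..v}. {i} \<in> \<Delta>)"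

definition complex_dim :: "nat set set \<Rightarrow> int" where
  "complex_dim \<Delta> = Max ((\<lambda>F. int (card F) - 1) ` \<Delta>)"

text \<open>
  A polynomial is a finitely supported map from monomials to coefficients, a monomial being the
  finitely supported map from (indices of) variables to exponents.
\<close>

type_synonym 'k mpoly = "(nat \<Rightarrow>\<^sub>0 nat) \<Rightarrow>\<^sub>0 'k"

definition polynomial_ring :: "nat \<Rightarrow> 'k::field mpoly ring" where
  "polynomial_ring v =
     \<lparr>carrier = {f. \<forall>m \<in> Poly_Mapping.keys f. Poly_Mapping.keys m \<subseteq> {1..v}},
      monoid.mult = (*), one = 1, zero = 0, add = (+)\<rparr>"

definition var_poly :: "nat \<Rightarrow> 'k::field mpoly" where
  "var_poly i = Poly_Mapping.single (Poly_Mapping.single i 1) 1"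

definition const_poly :: "'k \<Rightarrow> 'k::field mpoly" where
  "const_poly a = Poly_Mapping.single 0 a"

definition homogeneous :: "nat \<Rightarrow> 'k::field mpoly \<Rightarrow> bool" where
  "homogeneous j f \<longleftrightarrow>
     (\<forall>m \<in> Poly_Mapping.keys f. (\<Sum>i\<in>Poly_Mapping.keys m. Poly_Mapping.lookup m i) = j)"

definition stanley_reisner_ideal :: "nat \<Rightarrow> nat set set \<Rightarrow> 'k::field mpoly set" where
  "stanley_reisner_ideal v \<Delta> =
     Idl\<^bsub>polynomial_ring v\<^esub> {\<Prod>i\<in>F. var_poly i | F. F \<subseteq> {1..v} \<and> F \<notin> \<Delta>}"

definition stanley_reisner_ring :: "nat \<Rightarrow> nat set set \<Rightarrow> 'k::field mpoly set ring" where
  "stanley_reisner_ring v \<Delta> = polynomial_ring v Quot stanley_reisner_ideal v \<Delta>"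

definition sr_class :: "nat \<Rightarrow> nat set set \<Rightarrow> 'k::field mpoly \<Rightarrow> 'k mpoly set" where
  "sr_class v \<Delta> f = stanley_reisner_ideal v \<Delta> +>\<^bsub>polynomial_ring v\<^esub> f"

definition sr_scalars :: "nat \<Rightarrow> nat set set \<Rightarrow> 'k::field mpoly set set" where
  "sr_scalars v \<Delta> = range (\<lambda>a. sr_class v \<Delta> (const_poly a))"

definition sr_component :: "nat \<Rightarrow> nat set set \<Rightarrow> nat \<Rightarrow> 'k::field mpoly set set" where
  "sr_component v \<Delta> j = sr_class v \<Delta> ` {f \<in> carrier (polynomial_ring v). homogeneous j f}"

end

theory Submission
  imports Defs
begin

text \<open>
  Restricting to the variables of a face \<open>F\<close> is a homomorphism from \<open>R\<close> to a polynomial ring, and these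
  homomorphisms for the facets \<open>F\<close> are jointly injective with the minimal primes of \<open>R\<close> as kernels. An ideal
  generated by a linear system of parameters restricts on \<open>F\<close> to the ideal of all the variables of \<open>F\<close>: if
  its linear forms had a common zero \<open>w \<noteq> 0\<close>, evaluation at \<open>t w\<close> would give an infinite chain of ideals in
  the quotient. Hence \<open>J = I\<^sub>1\<^bsup>s\<^sub>1\<^esup>\<cdots>I\<^sub>g\<^bsup>s\<^sub>g\<^esup>\<close> agrees with \<open>\<mm>\<^bsup>n+1\<^esup>\<close> on every facet, which gives
  \<open>\<mm>\<^bsup>n+1\<^esup> \<subseteq> J\<^sup>*\<close>. The reverse inclusion compares orders at the origin on a facet: if \<open>x\<close> has order
  at most \<open>n\<close>, then that of \<open>c x\<^sup>q\<close> is at most \<open>ord c + q n < q (n + 1)\<close> for large \<open>q\<close>. What remains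
  is to count the monomials supported on faces.
\<close>

subsection \<open>Monomials\<close>

text \<open>The obstacle is that \<open>J\<close> need not equal \<mm>^(n+1) in \<open>R\<close>:
  the two agree only after restriction to a face, and different faces may call for different
  elements of \<open>J\<close>. Tight closure glues these local agreements, because its multiplier
  may be a sum of monomials each of which lives on a single facet. The agreement is preserved by
  products of ideals, so it is enough to establish it for each \<open>I i\<close> with exponent 1,
  and it then holds for every power of \<open>J\<close> as well. This yields (J^N)^* =
  \<mm>^((n+1)N), from which the last tight Hilbert coefficient is read off. The common zero
  \<open>w\<close> comes from linear algebra over the given field: if the restrictions of the ideal
  miss a variable, some linear functional kills them all and takes the value 1 at that variable, and
  its values at the variables are the coordinates of \<open>w\<close>. Since the parameters are
  linear forms, no field extension is involved. Elements of \<open>R\<close> are cosets; orders,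
  restrictions and monomial counts all refer to their normal forms, the representatives that contain
  only monomials supported on faces.\<close>

abbreviation coef :: "('a \<Rightarrow>\<^sub>0 'b::zero) \<Rightarrow> 'a \<Rightarrow> 'b" where
  "coef \<equiv> Poly_Mapping.lookup"

abbreviation supp :: "('a \<Rightarrow>\<^sub>0 'b::zero) \<Rightarrow> 'a set" where
  "supp \<equiv> Poly_Mapping.keys"

lemma supp_empty_iff: "supp f = {} \<longleftrightarrow> f = 0"
  by (auto simp: in_keys_iff poly_mapping_eq_iff fun_eq_iff)

definition mdeg :: "(nat \<Rightarrow>\<^sub>0 nat) \<Rightarrow> nat" where
  "mdeg m = (\<Sum>i\<in>supp m. coef m i)"

lemma mdeg_superset: "finite A \<Longrightarrow> supp m \<subseteq> A \<Longrightarrow> mdeg m = (\<Sum>i\<in>A. coef m i)"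
  unfolding mdeg_def by (rule sum.mono_neutral_left) (auto simp: in_keys_iff)

lemma mdeg_zero [simp]: "mdeg 0 = 0"
  by (simp add: mdeg_def)

lemma mdeg_single [simp]: "mdeg (Poly_Mapping.single i n) = n"
  by (simp add: mdeg_def)

lemma supp_add_nat: "supp (m + n) = supp m \<union> supp (n :: 'a \<Rightarrow>\<^sub>0 nat)"
  by (auto simp: in_keys_iff lookup_add)

lemma mdeg_add [simp]: "mdeg (m + n) = mdeg m + mdeg n"
proof -
  let ?A = "supp m \<union> supp n"
  have "mdeg (m + n) = (\<Sum>i\<in>?A. coef (m + n) i)"
    by (rule mdeg_superset) (auto simp: supp_add_nat)
  also have "\<dots> = (\<Sum>i\<in>?A. coef m i) + (\<Sum>i\<in>?A. coef n i)"
    by (simp add: lookup_add sum.distrib)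
  also have "\<dots> = mdeg m + mdeg n"
    by (simp add: mdeg_superset[of ?A])
  finally show ?thesis .
qed

lemma mdeg_eq_0_iff [simp]: "mdeg m = 0 \<longleftrightarrow> m = 0"
  by (auto simp: mdeg_def in_keys_iff poly_mapping_eq_iff fun_eq_iff)

lemma monomial_split_var:
  fixes m :: "nat \<Rightarrow>\<^sub>0 nat"
  assumes "i \<in> supp m"
  obtains n where "m = Poly_Mapping.single i 1 + n"
proof
  show "m = Poly_Mapping.single i 1 + (m - Poly_Mapping.single i (1::nat))"
    using assms
    by (intro poly_mapping_eqI) (auto simp: lookup_add lookup_minus lookup_single in_keys_iff when_def)
qed

text \<open>Used for \<mm>^(k+l) = \<mm>^k \<mm>^l: a monomial of degree at least k + l gives up a
  factor of degree exactly k.\<close>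

lemma monomial_split:
  assumes "k \<le> mdeg m"
  shows "\<exists>m1 m2. m = m1 + m2 \<and> mdeg m1 = k"
  using assms
proof (induction k)
  case 0
  show ?case by (intro exI[of _ 0] exI[of _ m]) simp
next
  case (Suc k)
  then obtain m1 m2 where m: "m = m1 + m2" "mdeg m1 = k" by auto
  with Suc.prems have "m2 \<noteq> 0" by auto
  then obtain i where "i \<in> supp m2" using supp_empty_iff by fastforce
  then obtain n where n: "m2 = Poly_Mapping.single i 1 + n" by (rule monomial_split_var)
  show ?case
    by (intro exI[of _ "m1 + Poly_Mapping.single i 1"] exI[of _ n]) (simp add: m n add.assoc)
qed

lemma finite_monomials:
  assumes "finite A"
  shows "finite {m. supp m \<subseteq> A \<and> mdeg m \<le> k}"
proof -
  have "inj_on coef {m. supp m \<subseteq> A \<and> mdeg m \<le> k}"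
    by (auto simp: inj_on_def lookup_inject)
  moreover have "coef ` {m. supp m \<subseteq> A \<and> mdeg m \<le> k} \<subseteq> {f. \<forall>i. (i \<in> A \<longrightarrow> f i \<in> {..k}) \<and> (i \<notin> A \<longrightarrow> f i = 0)}"
  proof safe
    fix m i assume m: "supp m \<subseteq> A" "mdeg m \<le> k" and i: "i \<in> A"
    have "coef m i \<le> (\<Sum>i\<in>A. coef m i)" using i assms by (simp add: member_le_sum)
    with m show "coef m i \<le> k" by (simp add: mdeg_superset[OF assms])
  next
    fix m i assume "supp m \<subseteq> A" "i \<notin> A"
    then show "coef m i = 0" by (auto simp: in_keys_iff)
  qed
  ultimately show ?thesis
    using finite_set_of_finite_funs[of A "{..k}" 0] assms
    by (meson finite_atMost finite_imageD finite_subset)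
qed


subsection \<open>Restricting the monomials of a polynomial\<close>

text \<open>The predicate \<open>Q\<close> carries what is known about the monomials of
  \<open>f\<close> into the \<open>single\<close> case, so that later inductions may run over face
  monomials, or over monomials of large degree, only.\<close>

lemma mpoly_induct [consumes 1, case_names zero single add]:
  fixes f :: "'a \<Rightarrow>\<^sub>0 'b::comm_monoid_add"
  assumes "\<forall>m\<in>supp f. Q m"
    and "P 0"
    and "\<And>m c. Q m \<Longrightarrow> P (Poly_Mapping.single m c)"
    and "\<And>f g. P f \<Longrightarrow> P g \<Longrightarrow> P (f + g)"
  shows "P f"
proof -
  have *: "finite A \<Longrightarrow> \<forall>m\<in>A. Q m \<Longrightarrow> supp f \<subseteq> A \<Longrightarrow> P f" for A f
  proof (induction A arbitrary: f rule: finite_induct)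
    case empty
    then have "f = 0" by (auto intro: poly_mapping_eqI simp: in_keys_iff)
    then show ?case using assms(2) by simp
  next
    case (insert x A)
    define g where "g = Poly_Mapping.update x 0 f"
    have "supp g \<subseteq> A" using insert.prems by (auto simp: g_def keys_update)
    then have "P g" using insert by auto
    have "f = Poly_Mapping.single x (coef f x) + g"
      by (intro poly_mapping_eqI) (auto simp: g_def lookup_add lookup_update lookup_single when_def)
    then show ?case using assms(3,4) \<open>P g\<close> insert.prems(1) by (metis insertI1)
  qed
  show ?thesis using *[of "supp f" f] assms(1) by simp
qed

lemma mpoly_induct_all [case_names zero single add]:
  fixes f :: "'a \<Rightarrow>\<^sub>0 'b::comm_monoid_add"
  assumes "P 0" and "\<And>m c. P (Poly_Mapping.single m c)"
    and "\<And>f g. P f \<Longrightarrow> P g \<Longrightarrow> P (f + g)"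
  shows "P f"
  by (rule mpoly_induct[where Q = "\<lambda>_. True"]) (use assms in auto)

text \<open>One operation provides several projections: reduction to face monomials, restriction to
  the variables of a face, the homogeneous part of lowest degree, and truncation at a
  degree.\<close>

definition filt :: "('a \<Rightarrow> bool) \<Rightarrow> ('a \<Rightarrow>\<^sub>0 'b::zero) \<Rightarrow> 'a \<Rightarrow>\<^sub>0 'b" where
  "filt P f = Abs_poly_mapping (\<lambda>m. coef f m when P m)"

lemma lookup_filt: "coef (filt P f) m = (coef f m when P m)"
proof -
  have "finite {m. (coef f m when P m) \<noteq> 0}"
    by (rule finite_subset[OF _ finite_keys[of f]]) (auto simp: in_keys_iff)
  then show ?thesis by (simp add: filt_def)
qed

lemma supp_filt: "supp (filt P f) = {m \<in> supp f. P m}"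
  by (auto simp: in_keys_iff lookup_filt)

lemma filt_id: "(\<And>m. m \<in> supp f \<Longrightarrow> P m) \<Longrightarrow> filt P f = f"
  by (rule poly_mapping_eqI) (auto simp: lookup_filt when_def in_keys_iff)

lemma filt_eq_0_iff: "filt P f = 0 \<longleftrightarrow> (\<forall>m\<in>supp f. \<not> P m)"
  by (auto simp: poly_mapping_eq_iff fun_eq_iff lookup_filt when_def in_keys_iff)

lemma filt_zero [simp]: "filt P 0 = 0"
  by (simp add: filt_eq_0_iff)

lemma filt_filt [simp]: "filt P (filt Q f) = filt (\<lambda>m. P m \<and> Q m) f"
  by (rule poly_mapping_eqI) (auto simp: lookup_filt when_def)

lemma filt_add: "filt P (f + g) = filt P f + filt P (g :: 'a \<Rightarrow>\<^sub>0 'b::monoid_add)"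
  by (rule poly_mapping_eqI) (auto simp: lookup_filt lookup_add when_def)

lemma filt_diff: "filt P (f - g) = filt P f - filt P (g :: 'a \<Rightarrow>\<^sub>0 'b::ab_group_add)"
  by (rule poly_mapping_eqI) (auto simp: lookup_filt lookup_minus when_def)

lemma filt_uminus: "filt P (- f) = - filt P (f :: 'a \<Rightarrow>\<^sub>0 'b::ab_group_add)"
  by (rule poly_mapping_eqI) (auto simp: lookup_filt when_def)

lemma filt_sum: "filt P (sum f A) = (\<Sum>x\<in>A. filt P (f x :: 'a \<Rightarrow>\<^sub>0 'b::comm_monoid_add))"
  by (induction A rule: infinite_finite_induct) (simp_all add: filt_add)

lemma filt_single: "filt P (Poly_Mapping.single m c) = (Poly_Mapping.single m c when P m)"
  by (rule poly_mapping_eqI) (auto simp: lookup_filt lookup_single when_def)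

lemma filt_split: "f = filt P f + filt (\<lambda>m. \<not> P m) (f :: 'a \<Rightarrow>\<^sub>0 'b::monoid_add)"
  by (rule poly_mapping_eqI) (auto simp: lookup_filt lookup_add when_def)

lemma filt_eq_filt_iff: "filt P f = filt P g \<longleftrightarrow> (\<forall>m. P m \<longrightarrow> coef f m = coef g m)"
  by (auto simp: poly_mapping_eq_iff fun_eq_iff lookup_filt when_def)

lemma supp_mult_cases:
  assumes "m \<in> supp (f * g)"
  obtains a b where "a \<in> supp f" "b \<in> supp g" "m = a + b"
  using assms keys_mult[of f g] by blast

text \<open>Split each factor into its selected and rejected monomials: of the four products only
  selected times selected has monomials satisfying \<open>P\<close>. Separate predicates for the
  product and the factors cover both restriction to a face and initial forms; for the latter the
  equivalence holds only on monomials that actually occur.\<close>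

lemma filt_mult_split:
  fixes f g :: "'a::monoid_add \<Rightarrow>\<^sub>0 'b::semiring_0"
  assumes "\<And>m n. m \<in> supp f \<Longrightarrow> n \<in> supp g \<Longrightarrow> P (m + n) \<longleftrightarrow> Q m \<and> Q' n"
  shows "filt P (f * g) = filt Q f * filt Q' g"
proof -
  let ?f = "filt Q f" and ?f' = "filt (\<lambda>m. \<not> Q m) f"
  let ?g = "filt Q' g" and ?g' = "filt (\<lambda>m. \<not> Q' m) g"
  have "f * g = (?f + ?f') * (?g + ?g')" by (metis filt_split)
  also have "\<dots> = ?f * ?g + (?f * ?g' + ?f' * ?g + ?f' * ?g')"
    by (simp add: algebra_simps)
  finally have "filt P (f * g) = filt P (?f * ?g) + (filt P (?f * ?g') + filt P (?f' * ?g) + filt P (?f' * ?g'))"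
    by (simp add: filt_add)
  also have "filt P (?f * ?g) = ?f * ?g"
    by (rule filt_id) (auto elim!: supp_mult_cases simp: supp_filt assms)
  also have "filt P (?f * ?g') = 0"
    unfolding filt_eq_0_iff by (auto elim!: supp_mult_cases simp: supp_filt assms)
  also have "filt P (?f' * ?g) = 0"
    unfolding filt_eq_0_iff by (auto elim!: supp_mult_cases simp: supp_filt assms)
  also have "filt P (?f' * ?g') = 0"
    unfolding filt_eq_0_iff by (auto elim!: supp_mult_cases simp: supp_filt assms)
  finally show ?thesis by simp
qed

abbreviation restr :: "nat set \<Rightarrow> 'k::zero mpoly \<Rightarrow> 'k mpoly" where
  "restr F \<equiv> filt (\<lambda>m. supp m \<subseteq> F)"

text \<open>A product of monomials is supported in \<open>F\<close> exactly when both factors are,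
  so setting the variables outside \<open>F\<close> to zero is multiplicative.\<close>

lemma restr_mult: "restr F (f * g) = restr F f * restr F (g :: 'k::field mpoly)"
  by (rule filt_mult_split) (simp add: supp_add_nat)

lemma restr_one: "restr F (1 :: 'k::field mpoly) = 1"
  by (rule filt_id) simp


subsection \<open>The order of a polynomial\<close>

definition ord :: "'k::field mpoly \<Rightarrow> nat" where
  "ord f = Min (mdeg ` supp f)"

text \<open>The condition k \<le> ord f in a form that also makes sense for f = 0, where
  \<open>ord\<close> would be the minimum of an empty set.\<close>

definition low :: "nat \<Rightarrow> 'k::field mpoly \<Rightarrow> bool" where
  "low k f \<longleftrightarrow> (\<forall>m\<in>supp f. k \<le> mdeg m)"

lemma low_iff_ord: "f \<noteq> 0 \<Longrightarrow> low k f \<longleftrightarrow> k \<le> ord f"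
  by (simp add: low_def ord_def Min_ge_iff supp_empty_iff)

lemma low_zero [simp]: "low k 0"
  by (simp add: low_def)

lemma low_0 [simp]: "low 0 f"
  by (simp add: low_def)

lemma low_add: "low k f \<Longrightarrow> low k g \<Longrightarrow> low k (f + g)"
  unfolding low_def using keys_add[of f g] by blast

lemma low_mult: "low k f \<Longrightarrow> low l g \<Longrightarrow> low (k + l) (f * g)"
  unfolding low_def by (auto elim!: supp_mult_cases intro!: add_mono)

lemma low_filt: "low k f \<Longrightarrow> low k (filt P f)"
  by (simp add: low_def supp_filt)

text \<open>The part of degree ord f + ord g of the product is the product of the two initial forms,
  and this is nonzero because a polynomial ring over a field is a domain.\<close>

lemma ord_mult:
  fixes f g :: "'k::field mpoly"
  assumes f: "f \<noteq> 0" and g: "g \<noteq> 0"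
  shows "ord (f * g) = ord f + ord g"
proof (rule antisym)
  have low: "low (ord f) f" "low (ord g) g" using f g by (simp_all add: low_iff_ord)
  have fg: "f * g \<noteq> 0" using f g by simp
  from low show "ord f + ord g \<le> ord (f * g)"
    using low_mult low_iff_ord[OF fg] by blast
  have nz: "filt (\<lambda>m. mdeg m = ord h) h \<noteq> 0" if "h \<noteq> 0" for h :: "'k mpoly"
  proof -
    have "ord h \<in> mdeg ` supp h"
      unfolding ord_def using that by (intro Min_in) (auto simp: supp_empty_iff)
    then show ?thesis by (auto simp: filt_eq_0_iff)
  qed
  have "filt (\<lambda>m. mdeg m = ord f + ord g) (f * g)
      = filt (\<lambda>m. mdeg m = ord f) f * filt (\<lambda>m. mdeg m = ord g) g"
    using low by (intro filt_mult_split) (fastforce simp: low_def)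
  also have "\<dots> \<noteq> 0" using nz f g by simp
  finally obtain m where "m \<in> supp (f * g)" "mdeg m = ord f + ord g"
    by (auto simp: filt_eq_0_iff)
  then have "mdeg m \<in> mdeg ` supp (f * g)" "mdeg m = ord f + ord g" by blast+
  then show "ord (f * g) \<le> ord f + ord g"
    unfolding ord_def[of "f * g"] using Min_le[of "mdeg ` supp (f * g)" "mdeg m"] by simp
qed

lemma ord_power:
  fixes f :: "'k::field mpoly"
  assumes "f \<noteq> 0"
  shows "ord (f ^ n) = n * ord f"
proof (induction n)
  case 0
  show ?case by (simp add: ord_def)
next
  case (Suc n)
  then show ?case using assms by (simp add: ord_mult)
qed

lemma filt_const_mult: "filt P (const_poly c * f) = const_poly c * filt P f"
proof -
  have "filt P (const_poly c * f) = filt (\<lambda>_. True) (const_poly c) * filt P f"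
    by (rule filt_mult_split) (auto simp: const_poly_def split: if_splits)
  then show ?thesis by (simp add: filt_id)
qed

lemma lookup_const_mult: "coef (const_poly c * f) m = c * coef f m"
proof (induction f rule: mpoly_induct_all)
  case (single n d)
  show ?case by (simp add: const_poly_def mult_single lookup_single when_def)
qed (simp_all add: lookup_add algebra_simps)

lemma supp_const_mult: "supp (const_poly c * f) \<subseteq> supp f"
  by (auto simp: in_keys_iff lookup_const_mult)


subsection \<open>Evaluation along a line through the origin\<close>

text \<open>The polynomial \<open>f(w\<^sub>1 t, w\<^sub>2 t, \<dots>)\<close> in the variable \<open>t\<close>.\<close>

definition mon_eval :: "(nat \<Rightarrow> 'k::field) \<Rightarrow> (nat \<Rightarrow>\<^sub>0 nat) \<Rightarrow> 'k" where
  "mon_eval w m = (\<Prod>i\<in>supp m. w i ^ coef m i)"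

definition line_eval :: "(nat \<Rightarrow> 'k::field) \<Rightarrow> 'k mpoly \<Rightarrow> 'k poly" where
  "line_eval w f = (\<Sum>m\<in>supp f. Polynomial.monom (coef f m * mon_eval w m) (mdeg m))"

lemma mon_eval_superset:
  "finite A \<Longrightarrow> supp m \<subseteq> A \<Longrightarrow> mon_eval w m = (\<Prod>i\<in>A. w i ^ coef m i)"
  unfolding mon_eval_def by (rule prod.mono_neutral_left) (auto simp: in_keys_iff)

lemma mon_eval_add: "mon_eval w (m + n) = mon_eval w m * mon_eval w n"
proof -
  let ?A = "supp m \<union> supp n"
  have "mon_eval w (m + n) = (\<Prod>i\<in>?A. w i ^ coef (m + n) i)"
    by (rule mon_eval_superset) (auto simp: supp_add_nat)
  also have "\<dots> = (\<Prod>i\<in>?A. w i ^ coef m i) * (\<Prod>i\<in>?A. w i ^ coef n i)"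
    by (simp add: lookup_add prod.distrib power_add)
  also have "\<dots> = mon_eval w m * mon_eval w n"
    by (simp add: mon_eval_superset[of ?A])
  finally show ?thesis .
qed

lemma line_eval_superset:
  "finite A \<Longrightarrow> supp f \<subseteq> A \<Longrightarrow>
    line_eval w f = (\<Sum>m\<in>A. Polynomial.monom (coef f m * mon_eval w m) (mdeg m))"
  unfolding line_eval_def by (rule sum.mono_neutral_left) (auto simp: in_keys_iff)

lemma line_eval_zero [simp]: "line_eval w 0 = 0"
  by (simp add: line_eval_def)

lemma line_eval_single:
  "line_eval w (Poly_Mapping.single m c) = Polynomial.monom (c * mon_eval w m) (mdeg m)"
  by (simp add: line_eval_def)

lemma line_eval_add: "line_eval w (f + g) = line_eval w f + line_eval w g"
proof -
  let ?A = "supp f \<union> supp g"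
  have "line_eval w (f + g) = (\<Sum>m\<in>?A. Polynomial.monom (coef (f + g) m * mon_eval w m) (mdeg m))"
    using keys_add[of f g] by (intro line_eval_superset) auto
  also have "\<dots> = (\<Sum>m\<in>?A. Polynomial.monom (coef f m * mon_eval w m) (mdeg m))
      + (\<Sum>m\<in>?A. Polynomial.monom (coef g m * mon_eval w m) (mdeg m))"
    by (simp add: lookup_add algebra_simps add_monom sum.distrib[symmetric])
  also have "\<dots> = line_eval w f + line_eval w g"
    by (simp add: line_eval_superset[of ?A])
  finally show ?thesis .
qed

lemma line_eval_mult: "line_eval w (f * g) = line_eval w f * line_eval w g"
proof (induction f rule: mpoly_induct_all)
  case (single m c)
  show ?case
  proof (induction g rule: mpoly_induct_all)
    case (single n d)
    show ?case
      by (simp add: line_eval_single mult_single mult_monom mon_eval_add algebra_simps)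
  qed (simp_all add: line_eval_add algebra_simps)
qed (simp_all add: line_eval_add algebra_simps)

lemma line_eval_one: "line_eval w 1 = 1"
  by (simp add: line_eval_def mon_eval_def)

lemma line_eval_power: "line_eval w (f ^ n) = line_eval w f ^ n"
  by (induction n) (simp_all add: line_eval_mult line_eval_one)

text \<open>A basis of \<open>U\<close> stays independent when \<open>x\<close> is added, so the
  functional may be prescribed as 0 on that basis and 1 at \<open>x\<close> and then extended. Its
  values at the variables become the coordinates of a common zero in
  \<open>linear_sop_spans_face\<close>.\<close>

lemma exists_functional:
  fixes U :: "'k::field mpoly set"
  assumes "0 \<in> U" and "\<And>f g. f \<in> U \<Longrightarrow> g \<in> U \<Longrightarrow> f + g \<in> U"
    and "\<And>c f. f \<in> U \<Longrightarrow> const_poly c * f \<in> U"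
    and "x \<notin> U"
  obtains \<phi> :: "'k mpoly \<Rightarrow> 'k"
  where "\<And>f g. \<phi> (f + g) = \<phi> f + \<phi> g" "\<And>c f. \<phi> (const_poly c * f) = c * \<phi> f"
    "\<And>f. f \<in> U \<Longrightarrow> \<phi> f = 0" "\<phi> x = 1"
proof -
  interpret vs: vector_space "\<lambda>c (f::'k mpoly). const_poly c * f"
    by unfold_locales
      (simp_all add: const_poly_def algebra_simps single_add mult_single flip: mult.assoc)
  interpret vp: vector_space_pair "\<lambda>c (f::'k mpoly). const_poly c * f" "(*) :: 'k \<Rightarrow> 'k \<Rightarrow> 'k"
    by unfold_locales (simp_all add: algebra_simps)
  have U: "vs.subspace U"
    using assms by (simp add: vs.subspace_def)
  obtain B where B: "B \<subseteq> U" "vs.independent B" "U \<subseteq> vs.span B"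
    using vs.maximal_independent_subset by blast
  then have UB: "vs.span B = U"
    using U vs.span_minimal by blast
  then have "vs.independent (insert x B)"
    using B assms(4) vs.independent_insertI by blast
  then obtain \<phi> where \<phi>: "Vector_Spaces.linear (\<lambda>c (f::'k mpoly). const_poly c * f) (*) \<phi>"
    "\<forall>y\<in>insert x B. \<phi> y = (if y = x then 1 else 0)"
    using vp.linear_independent_extend[where f = "\<lambda>y. if y = x then 1 else 0"] by blast
  interpret l: Vector_Spaces.linear "\<lambda>c (f::'k mpoly). const_poly c * f" "(*)" \<phi>
    by (rule \<phi>(1))
  show thesis
  proof
    show "\<phi> (f + g) = \<phi> f + \<phi> g" for f g by (rule l.add)
    show "\<phi> (const_poly c * f) = c * \<phi> f" for c f by (rule l.scale)
    show "\<phi> x = 1" using \<phi>(2) by simp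
    have "\<phi> y = 0" if "y \<in> B" for y
      using \<phi>(2) that B(1) assms(4) by auto
    then show "\<phi> f = 0" if "f \<in> U" for f
      using vp.linear_eq_0_on_span[OF \<phi>(1)] that UB by blast
  qed
qed


subsection \<open>Polynomial rings and Stanley-Reisner rings\<close>

lemma carrier_polynomial_ring: "carrier (polynomial_ring v) = {f. \<forall>m\<in>supp f. supp m \<subseteq> {1..v}}"
  by (simp add: polynomial_ring_def)

lemma polynomial_ring_simps [simp]:
  "f \<otimes>\<^bsub>polynomial_ring v\<^esub> g = f * g" "f \<oplus>\<^bsub>polynomial_ring v\<^esub> g = f + g"
  "\<one>\<^bsub>polynomial_ring v\<^esub> = 1" "\<zero>\<^bsub>polynomial_ring v\<^esub> = 0"
  by (simp_all add: polynomial_ring_def)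

lemma polynomial_ring_closed:
  fixes f g :: "'k::field mpoly"
  shows "f \<in> carrier (polynomial_ring v) \<Longrightarrow> g \<in> carrier (polynomial_ring v) \<Longrightarrow> f * g \<in> carrier (polynomial_ring v)"
    and "f \<in> carrier (polynomial_ring v) \<Longrightarrow> g \<in> carrier (polynomial_ring v) \<Longrightarrow> f + g \<in> carrier (polynomial_ring v)"
    and "f \<in> carrier (polynomial_ring v) \<Longrightarrow> - f \<in> carrier (polynomial_ring v)"
    and "0 \<in> carrier (polynomial_ring v)" and "1 \<in> carrier (polynomial_ring v)"
proof -
  show "f * g \<in> carrier (polynomial_ring v)"
    if "f \<in> carrier (polynomial_ring v)" "g \<in> carrier (polynomial_ring v)"
    using that unfolding carrier_polynomial_ring
    by (simp add: Ball_def) (metis Un_least supp_add_nat supp_mult_cases)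
  show "f + g \<in> carrier (polynomial_ring v)"
    if "f \<in> carrier (polynomial_ring v)" "g \<in> carrier (polynomial_ring v)"
    using that keys_add[of f g] unfolding carrier_polynomial_ring by blast
qed (auto simp: carrier_polynomial_ring in_keys_iff)

lemma cring_polynomial_ring: "cring (polynomial_ring v :: 'k::field mpoly ring)"
proof (rule cringI)
  show "abelian_group (polynomial_ring v :: 'k mpoly ring)"
    by (rule abelian_groupI)
      (auto simp: polynomial_ring_closed algebra_simps intro: polynomial_ring_closed(3)[THEN rev_bexI])
  show "comm_monoid (polynomial_ring v :: 'k mpoly ring)"
    by (rule comm_monoidI) (auto simp: polynomial_ring_closed algebra_simps)
qed (auto simp: algebra_simps)

lemma a_minus_polynomial_ring [simp]:
  assumes "f \<in> carrier (polynomial_ring v)"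
  shows "\<ominus>\<^bsub>polynomial_ring v\<^esub> f = - (f :: 'k::field mpoly)"
proof -
  interpret cring "polynomial_ring v :: 'k mpoly ring" by (rule cring_polynomial_ring)
  show ?thesis
    using minus_equality[of "- f" f] assms by (simp add: polynomial_ring_closed)
qed

definition face_monomial :: "nat set \<Rightarrow> nat \<Rightarrow>\<^sub>0 nat" where
  "face_monomial F = (\<Sum>i\<in>F. Poly_Mapping.single i 1)"

lemma lookup_face_monomial: "finite F \<Longrightarrow> coef (face_monomial F) i = (if i \<in> F then 1 else 0)"
  by (simp add: face_monomial_def lookup_sum lookup_single when_def)

lemma supp_face_monomial [simp]: "finite F \<Longrightarrow> supp (face_monomial F) = F"
  by (auto simp: in_keys_iff lookup_face_monomial split: if_splits)

lemma prod_var_poly: "finite F \<Longrightarrow>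
  (\<Prod>i\<in>F. var_poly i) = (Poly_Mapping.single (face_monomial F) 1 :: 'k::field mpoly)"
  by (induction F rule: finite_induct) (simp_all add: var_poly_def mult_single face_monomial_def)

lemma monomial_split_support:
  assumes "supp m = F"
  obtains n where "m = face_monomial F + n"
proof
  have "finite F" using assms finite_keys by auto
  then show "m = face_monomial F + (m - face_monomial F)"
    using assms by (intro poly_mapping_eqI)
      (auto simp: lookup_add lookup_minus lookup_face_monomial in_keys_iff)
qed

locale stanley_reisner =
  fixes v :: nat and \<Delta> :: "nat set set" and R :: "'k::field mpoly set ring" (structure)
  assumes complex: "simplicial_complex v \<Delta>"
    and R_def: "R = stanley_reisner_ring v \<Delta>"
begin

abbreviation S :: "'k mpoly ring" where "S \<equiv> polynomial_ring v"
abbreviation \<II> :: "'k mpoly set" where "\<II> \<equiv> stanley_reisner_ideal v \<Delta>"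
abbreviation \<pi> :: "'k mpoly \<Rightarrow> 'k mpoly set" where "\<pi> \<equiv> sr_class v \<Delta>"
abbreviation face :: "(nat \<Rightarrow>\<^sub>0 nat) \<Rightarrow> bool" where "face m \<equiv> supp m \<in> \<Delta>"

sublocale S: cring S by (rule cring_polynomial_ring)

lemma face_subset: "F \<in> \<Delta> \<Longrightarrow> F \<subseteq> {1..v}"
  and empty_face: "{} \<in> \<Delta>"
  and subface: "F \<in> \<Delta> \<Longrightarrow> G \<subseteq> F \<Longrightarrow> G \<in> \<Delta>"
  using complex by (auto simp: simplicial_complex_def)

lemma finite_face: "F \<in> \<Delta> \<Longrightarrow> finite F"
  using face_subset finite_subset by blast

lemma finite_complex: "finite \<Delta>"
  using face_subset by (intro finite_subset[of \<Delta> "Pow {1..v}"]) auto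

lemma face_addD: "face (m + n) \<Longrightarrow> face m" "face (m + n) \<Longrightarrow> face n"
  by (auto simp: supp_add_nat intro: subface)

text \<open>The ideal is spanned by the monomials whose support is not a face: each of them is a
  multiple of the squarefree generator of its support. Conversely, their span is an ideal, because
  every divisor of a face monomial is again a face monomial.\<close>

lemma sr_ideal_eq: "\<II> = {f \<in> carrier S. filt face f = 0}" (is "_ = ?J")
proof
  let ?G = "{\<Prod>i\<in>F. var_poly i | F. F \<subseteq> {1..v} \<and> F \<notin> \<Delta>} :: 'k mpoly set"
  have G: "?G = {Poly_Mapping.single (face_monomial F) 1 | F. F \<subseteq> {1..v} \<and> F \<notin> \<Delta>}"
  proof -
    have "(\<Prod>i\<in>F. var_poly i) = (Poly_Mapping.single (face_monomial F) 1 :: 'k mpoly)" if "F \<subseteq> {1..v}" for F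
      using that by (simp add: prod_var_poly finite_subset)
    then show ?thesis by (smt (verit, ccfv_threshold) Collect_cong)
  qed
  have closed: "?G \<subseteq> carrier S"
    unfolding G carrier_polynomial_ring
    by (auto simp: finite_subset[OF _ finite_atLeastAtMost] simp del: atLeastAtMost_iff)
  have J: "ideal ?J S"
  proof (rule idealI)
    show "subgroup ?J (add_monoid S)"
    proof (rule S.add.subgroupI)
      show "\<ominus>\<^bsub>S\<^esub> f \<in> ?J" if "f \<in> ?J" for f
        using that by (simp add: filt_uminus polynomial_ring_closed)
    qed (auto simp: filt_add polynomial_ring_closed)
    show "x \<otimes>\<^bsub>S\<^esub> a \<in> ?J" "a \<otimes>\<^bsub>S\<^esub> x \<in> ?J" if "a \<in> ?J" "x \<in> carrier S" for a x
    proof -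
      have "filt face (x * a) = 0"
        using that unfolding filt_eq_0_iff by (blast elim: supp_mult_cases dest: face_addD)
      then show "x \<otimes>\<^bsub>S\<^esub> a \<in> ?J" "a \<otimes>\<^bsub>S\<^esub> x \<in> ?J"
        using that by (simp_all add: polynomial_ring_closed mult.commute)
    qed
  qed (rule S.ring_axioms)
  show "\<II> \<subseteq> ?J"
    unfolding stanley_reisner_ideal_def
  proof (rule S.genideal_minimal[OF J])
    show "?G \<subseteq> ?J"
      unfolding G using closed[unfolded G] by (auto simp: filt_single finite_subset when_def)
  qed
  interpret I: ideal \<II> S
    unfolding stanley_reisner_ideal_def by (rule S.genideal_ideal[OF closed])
  have gen: "?G \<subseteq> \<II>"
    unfolding stanley_reisner_ideal_def by (rule S.genideal_self[OF closed])
  show "?J \<subseteq> \<II>"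
  proof
    fix f assume "f \<in> ?J"
    then have "\<forall>m\<in>supp f. supp m \<subseteq> {1..v} \<and> \<not> face m"
      by (auto simp: carrier_polynomial_ring filt_eq_0_iff)
    then show "f \<in> \<II>"
    proof (induction f rule: mpoly_induct)
      case zero
      show ?case using I.zero_closed by simp
    next
      case (single m c)
      obtain n where n: "m = face_monomial (supp m) + n" using monomial_split_support by blast
      have "Poly_Mapping.single (face_monomial (supp m)) 1 \<in> \<II>"
        using single gen unfolding G by blast
      moreover have "Poly_Mapping.single n c \<in> carrier S"
      proof -
        have "supp n \<subseteq> supp m" by (subst n) (simp add: supp_add_nat)
        then show ?thesis using single by (auto simp: carrier_polynomial_ring)
      qed
      ultimately have "Poly_Mapping.single (face_monomial (supp m)) 1 * Poly_Mapping.single n c \<in> \<II>"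
        using I.I_r_closed by fastforce
      then show ?case using n by (simp add: mult_single)
    next
      case (add f g)
      then show ?case using I.a_closed by fastforce
    qed
  qed
qed

sublocale I: ideal \<II> S
proof -
  have "{\<Prod>i\<in>F. var_poly i | F. F \<subseteq> {1..v} \<and> F \<notin> \<Delta>} \<subseteq> carrier S"
    unfolding carrier_polynomial_ring
    by (auto simp: prod_var_poly finite_subset[OF _ finite_atLeastAtMost] simp del: atLeastAtMost_iff)
  then show "ideal \<II> S"
    unfolding stanley_reisner_ideal_def by (rule S.genideal_ideal)
qed

sublocale R: cring R
  unfolding R_def stanley_reisner_ring_def by (rule I.quotient_is_cring[OF cring_polynomial_ring])

sublocale \<pi>: ring_hom_ring S R \<pi>
  unfolding R_def stanley_reisner_ring_def sr_class_def[abs_def] by (rule I.rcos_ring_hom_ring)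

lemma carrier_R: "carrier R = \<pi> ` carrier S"
  by (auto simp: R_def stanley_reisner_ring_def FactRing_def A_RCOSETS_def' sr_class_def)

section \<open>Normal forms modulo the Stanley-Reisner ideal\<close>

lemma sr_class_eq_iff:
  assumes "f \<in> carrier S" "g \<in> carrier S"
  shows "\<pi> f = \<pi> g \<longleftrightarrow> filt face f = filt face g"
proof -
  have minus: "f \<ominus>\<^bsub>S\<^esub> g = f - g"
    unfolding a_minus_def a_minus_polynomial_ring[OF assms(2)] polynomial_ring_simps diff_conv_add_uminus ..
  have "f - g \<in> carrier S"
    using S.minus_closed[OF assms] unfolding minus .
  then have "f - g \<in> \<II> \<longleftrightarrow> filt face f = filt face g"
    unfolding sr_ideal_eq mem_Collect_eq filt_diff right_minus_eq by blast
  then show ?thesis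
    unfolding sr_class_def
    using S.quotient_eq_iff_same_a_r_cos[OF I.ideal_axioms assms, unfolded minus] by simp
qed

text \<open>The chosen representative does not matter: by \<open>sr_class_eq_iff\<close> all members
  of a coset have the same face monomials with the same coefficients.\<close>

definition nf :: "'k mpoly set \<Rightarrow> 'k mpoly" where
  "nf a = filt face (SOME f. f \<in> carrier S \<and> \<pi> f = a)"

lemma nf_sr_class: "f \<in> carrier S \<Longrightarrow> nf (\<pi> f) = filt face f"
  unfolding nf_def by (rule someI2[of _ f]) (auto simp: sr_class_eq_iff)

lemma faces_in_carrier: "(\<And>m. m \<in> supp f \<Longrightarrow> face m) \<Longrightarrow> f \<in> carrier S"
  using face_subset by (auto simp: carrier_polynomial_ring)

lemma filt_face_carrier [simp]: "filt face f \<in> carrier S"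
  by (rule faces_in_carrier) (simp add: supp_filt)

lemma nf_face:
  assumes "a \<in> carrier R"
  shows "m \<in> supp (nf a) \<Longrightarrow> face m" and "filt face (nf a) = nf a" and "nf a \<in> carrier S"
    and "\<pi> (nf a) = a"
proof -
  obtain f where f: "f \<in> carrier S" "a = \<pi> f" using assms by (auto simp: carrier_R)
  then have nf: "nf a = filt face f" by (simp add: nf_sr_class)
  show "m \<in> supp (nf a) \<Longrightarrow> face m" "filt face (nf a) = nf a" "nf a \<in> carrier S"
    unfolding nf by (simp_all add: supp_filt)
  have "\<pi> (filt face f) = \<pi> f" using f by (simp add: sr_class_eq_iff)
  then show "\<pi> (nf a) = a" using f nf by simp
qed

lemma sr_class_closed: "f \<in> carrier S \<Longrightarrow> \<pi> f \<in> carrier R"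
  by (simp add: carrier_R)

lemma nf_inject: "a \<in> carrier R \<Longrightarrow> b \<in> carrier R \<Longrightarrow> nf a = nf b \<longleftrightarrow> a = b"
  by (metis nf_face(4))

lemma sr_class_mult: "f \<in> carrier S \<Longrightarrow> g \<in> carrier S \<Longrightarrow> \<pi> (f * g) = \<pi> f \<otimes> \<pi> g"
  and sr_class_add: "f \<in> carrier S \<Longrightarrow> g \<in> carrier S \<Longrightarrow> \<pi> (f + g) = \<pi> f \<oplus> \<pi> g"
  and sr_class_one: "\<pi> 1 = \<one>"
  and sr_class_zero: "\<pi> 0 = \<zero>"
  by (use \<pi>.hom_mult[of f g] in simp, use \<pi>.hom_add[of f g] in simp,
      use \<pi>.hom_one in simp, use \<pi>.hom_zero in simp)

lemma nf_mult:
  assumes "a \<in> carrier R" "b \<in> carrier R"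
  shows "nf (a \<otimes> b) = filt face (nf a * nf b)"
proof -
  have "a \<otimes> b = \<pi> (nf a * nf b)" using assms by (simp add: sr_class_mult nf_face(2-4))
  then show ?thesis using assms by (simp add: nf_sr_class polynomial_ring_closed nf_face(2-4))
qed

lemma nf_add:
  assumes "a \<in> carrier R" "b \<in> carrier R"
  shows "nf (a \<oplus> b) = nf a + nf b"
proof -
  have "a \<oplus> b = \<pi> (nf a + nf b)" using assms by (simp add: sr_class_add nf_face(2-4))
  then show ?thesis using assms by (simp add: nf_sr_class polynomial_ring_closed nf_face(2-4) filt_add)
qed

lemma nf_zero [simp]: "nf \<zero> = 0" and nf_one [simp]: "nf \<one> = 1"
proof -
  have "filt face 1 = (1 :: 'k mpoly)"
    by (rule filt_id) (simp add: empty_face)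
  then show "nf \<zero> = 0" "nf \<one> = 1"
    using nf_sr_class[of 0] nf_sr_class[of 1]
    by (simp_all add: sr_class_zero sr_class_one polynomial_ring_closed)
qed

lemma nf_eq_0_iff: "a \<in> carrier R \<Longrightarrow> nf a = 0 \<longleftrightarrow> a = \<zero>"
  using nf_inject[of a \<zero>] by simp

lemma one_not_zero: "\<one> \<noteq> \<zero>"
  using nf_inject[of \<one> \<zero>] by simp


subsection \<open>Restriction to a face\<close>

definition rs :: "nat set \<Rightarrow> 'k mpoly set \<Rightarrow> 'k mpoly" where
  "rs F a = restr F (nf a)"

text \<open>A monomial supported inside a face is a face monomial, so reduction modulo the
  Stanley-Reisner ideal is invisible on \<open>F\<close>. This is what makes \<open>rs F\<close> a
  ring homomorphism on \<open>R\<close> when \<open>F\<close> is a face.\<close>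

lemma restr_filt_face: "F \<in> \<Delta> \<Longrightarrow> restr F (filt face f) = restr F f"
  by (rule poly_mapping_eqI) (auto simp: lookup_filt when_def intro: subface)

lemma rs_sr_class: "F \<in> \<Delta> \<Longrightarrow> f \<in> carrier S \<Longrightarrow> rs F (\<pi> f) = restr F f"
  by (simp add: rs_def nf_sr_class restr_filt_face del: filt_filt)

lemma rs_mult: "F \<in> \<Delta> \<Longrightarrow> a \<in> carrier R \<Longrightarrow> b \<in> carrier R \<Longrightarrow> rs F (a \<otimes> b) = rs F a * rs F b"
  by (simp add: rs_def nf_mult restr_filt_face restr_mult del: filt_filt)

lemma rs_add: "a \<in> carrier R \<Longrightarrow> b \<in> carrier R \<Longrightarrow> rs F (a \<oplus> b) = rs F a + rs F b"
  by (simp add: rs_def nf_add filt_add)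

lemma rs_zero [simp]: "rs F \<zero> = 0" and rs_one [simp]: "rs F \<one> = 1"
  by (simp_all add: rs_def restr_one)

lemma rs_pow: "F \<in> \<Delta> \<Longrightarrow> a \<in> carrier R \<Longrightarrow> rs F (a [^] (n::nat)) = rs F a ^ n"
  by (induction n) (simp_all add: rs_mult mult.commute)

definition facets :: "nat set set" where
  "facets = {F \<in> \<Delta>. \<forall>G\<in>\<Delta>. F \<subseteq> G \<longrightarrow> F = G}"

lemma facet_face: "F \<in> facets \<Longrightarrow> F \<in> \<Delta>"
  by (simp add: facets_def)

lemma ex_facet:
  assumes "F \<in> \<Delta>"
  obtains G where "G \<in> facets" "F \<subseteq> G"
  using finite_has_maximal2[OF finite_complex assms] by (auto simp: facets_def)

text \<open>Every monomial of a normal form is supported on a face, hence inside some facet, where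
  its coefficient can be read off.\<close>

lemma eq_by_facets:
  assumes "a \<in> carrier R" "b \<in> carrier R" "\<And>F. F \<in> facets \<Longrightarrow> rs F a = rs F b"
  shows "a = b"
proof -
  have "coef (nf a) m = coef (nf b) m" for m
  proof (cases "face m")
    case True
    then obtain F where "F \<in> facets" "supp m \<subseteq> F" using ex_facet by blast
    then show ?thesis using assms(3)[of F] by (auto simp: rs_def filt_eq_filt_iff)
  next
    case False
    then have "m \<notin> supp (nf a)" "m \<notin> supp (nf b)" using nf_face(1) assms by blast+
    then show ?thesis by (simp add: in_keys_iff)
  qed
  then have "nf a = nf b" by (rule poly_mapping_eqI)
  then show ?thesis using assms nf_inject by blast
qed


subsection \<open>Powers of the maximal homogeneous ideal\<close>

text \<open>This is \<mm>^k described through orders of normal forms;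
  \<open>maximal_homogeneous_ideal_eq\<close> and \<open>D_pow_ideal\<close> provide the
  identification.\<close>

definition D :: "nat \<Rightarrow> 'k mpoly set set" where
  "D k = {a \<in> carrier R. low k (nf a)}"

lemma D_0: "D 0 = carrier R"
  by (simp add: D_def)

lemma D_carrier: "D k \<subseteq> carrier R"
  by (auto simp: D_def)

lemma D_mult: "a \<in> D k \<Longrightarrow> b \<in> D l \<Longrightarrow> a \<otimes> b \<in> D (k + l)"
  by (simp add: D_def nf_mult low_filt low_mult)

lemma D_pow: "a \<in> D k \<Longrightarrow> a [^] (n::nat) \<in> D (n * k)"
proof (induction n)
  case (Suc n)
  then show ?case using D_mult[of "a [^] n" "n * k" a k] by (simp add: add.commute)
qed (simp add: D_def)

lemma ideal_R_I:
  assumes "A \<subseteq> carrier R" "\<zero> \<in> A" "\<And>a b. a \<in> A \<Longrightarrow> b \<in> A \<Longrightarrow> a \<oplus> b \<in> A"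
    and "\<And>a x. a \<in> A \<Longrightarrow> x \<in> carrier R \<Longrightarrow> x \<otimes> a \<in> A"
  shows "ideal A R"
proof (rule idealI)
  show "subgroup A (add_monoid R)"
  proof (rule R.add.subgroupI)
    show "\<ominus> a \<in> A" if "a \<in> A" for a
      using assms(4)[OF that, of "\<ominus> \<one>"] that assms(1) R.l_minus[of \<one> a]
      by auto
  qed (use assms in auto)
  show "a \<otimes> x \<in> A" if "a \<in> A" "x \<in> carrier R" for a x
    using assms(4)[OF that] that assms(1) R.m_comm by auto
qed (use assms R.ring_axioms in auto)

lemma ideal_D: "ideal (D k) R"
proof (rule ideal_R_I)
  show "x \<otimes> a \<in> D k" if "a \<in> D k" "x \<in> carrier R" for a x
    using D_mult[of x 0 a k] that by (simp add: D_0)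
qed (auto simp: D_def nf_add low_add)

lemma mon_closed: "face m \<Longrightarrow> Poly_Mapping.single m c \<in> carrier S"
  by (rule faces_in_carrier) (auto split: if_splits)

lemma D_induct [consumes 1, case_names single add zero]:
  assumes "a \<in> D k"
    and "\<And>m c. face m \<Longrightarrow> k \<le> mdeg m \<Longrightarrow> P (\<pi> (Poly_Mapping.single m c))"
    and "\<And>a b. a \<in> carrier R \<Longrightarrow> b \<in> carrier R \<Longrightarrow> P a \<Longrightarrow> P b \<Longrightarrow> P (a \<oplus> b)"
    and "P \<zero>"
  shows "P a"
proof -
  have a: "a \<in> carrier R" "low k (nf a)" using assms(1) by (auto simp: D_def)
  \<comment> \<open>Membership in the carrier is carried along because the hypothesis on sums asks
    for it.\<close>
  have "P (\<pi> f) \<and> f \<in> carrier S" if "\<forall>m\<in>supp f. face m \<and> k \<le> mdeg m" for f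
    using that
  proof (induction f rule: mpoly_induct)
    case zero
    show ?case using assms(4) by (simp add: sr_class_zero polynomial_ring_closed)
  next
    case (single m c)
    then show ?case using assms(2) mon_closed by blast
  next
    case (add f g)
    then show ?case by (simp add: sr_class_add polynomial_ring_closed assms(3) sr_class_closed)
  qed
  moreover have "\<forall>m\<in>supp (nf a). face m \<and> k \<le> mdeg m"
    using a by (auto simp: low_def intro: nf_face(1))
  ultimately show ?thesis using a by (metis nf_face(4))
qed

lemma sr_class_mon_D: "face m \<Longrightarrow> k \<le> mdeg m \<Longrightarrow> \<pi> (Poly_Mapping.single m c) \<in> D k"
  by (simp add: D_def sr_class_closed mon_closed nf_sr_class low_def supp_filt)

text \<open>For the nontrivial inclusion it suffices to factor a single face monomial; both factors
  divide it and are therefore face monomials too.\<close>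

lemma D_prod: "ideal_prod R (D k) (D l) = D (k + l)"
proof
  interpret D: ideal "D (k + l)" R by (rule ideal_D)
  show "ideal_prod R (D k) (D l) \<subseteq> D (k + l)"
  proof
    fix x assume "x \<in> ideal_prod R (D k) (D l)"
    then show "x \<in> D (k + l)"
      by induction (auto intro: D_mult D.a_closed)
  qed
  interpret P: ideal "ideal_prod R (D k) (D l)" R
    by (rule R.ideal_prod_is_ideal[OF ideal_D ideal_D])
  show "D (k + l) \<subseteq> ideal_prod R (D k) (D l)"
  proof
    fix x assume "x \<in> D (k + l)"
    then show "x \<in> ideal_prod R (D k) (D l)"
    proof (induction x rule: D_induct)
      case (single m c)
      from single(2) have "k \<le> mdeg m" by simp
      then obtain m1 m2 where m: "m = m1 + m2" "mdeg m1 = k" using monomial_split by blast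
      with single have f: "face m1" "face m2" "l \<le> mdeg m2" by (auto dest: face_addD)
      have "\<pi> (Poly_Mapping.single m c) = \<pi> (Poly_Mapping.single m1 1) \<otimes> \<pi> (Poly_Mapping.single m2 c)"
        using f by (simp add: m mon_closed mult_single flip: sr_class_mult)
      then show ?case
        using f m by (auto intro!: ideal_prod.prod sr_class_mon_D)
    qed (auto intro: P.a_closed P.zero_closed)
  qed
qed

lemma ideals_set_simps: "x \<otimes>\<^bsub>ideals_set R\<^esub> y = ideal_prod R x y" "\<one>\<^bsub>ideals_set R\<^esub> = carrier R"
  "carrier (ideals_set R) = {I. ideal I R}"
  by (simp_all add: ideals_set_def)

sublocale ideals: comm_monoid "ideals_set R"
  by (rule R.ideals_set_is_comm_monoid)

lemma D_pow_ideal: "D k [^]\<^bsub>ideals_set R\<^esub> (n::nat) = D (n * k)"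
  by (induction n) (simp_all add: ideals_set_simps D_0 D_prod add.commute)

end

subsection \<open>Lengths of quotients\<close>

lemma quotient_module_simps:
  "carrier (quotient_module R J) = carrier (R Quot J)"
  "\<zero>\<^bsub>quotient_module R J\<^esub> = J"
  "x \<oplus>\<^bsub>quotient_module R J\<^esub> y = x \<oplus>\<^bsub>R Quot J\<^esub> y"
  "r \<odot>\<^bsub>quotient_module R J\<^esub> x = (J +>\<^bsub>R\<^esub> r) \<otimes>\<^bsub>R Quot J\<^esub> x"
  by (simp_all add: quotient_module_def FactRing_def)

lemma subgroup_add_monoid_quotient_module:
  "subgroup H (add_monoid (quotient_module R J)) \<longleftrightarrow> subgroup H (add_monoid (R Quot J))"
  by (simp add: subgroup_def m_inv_def quotient_module_def)

text \<open>The correspondence between submodules of the quotient and ideals containing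
  \<open>J\<close>, applied to whole chains. Preimages of distinct submodules are distinct because
  the quotient map is onto.\<close>

lemma (in cring) quotient_length_eq_Sup:
  assumes J: "ideal J R"
  shows "quotient_length R J =
    Sup {enat n | n. \<exists>L. (\<forall>i\<le>n. ideal (L i) R \<and> J \<subseteq> L i) \<and> (\<forall>i<n. L i \<subset> L (Suc i))}"
proof -
  interpret J: ideal J R by (rule J)
  let ?M = "quotient_module R J" and ?q = "\<lambda>r. J +> r"
  interpret q: ring_hom_ring R "R Quot J" ?q by (rule J.rcos_ring_hom_ring)
  have carrier: "carrier (R Quot J) = ?q ` carrier R"
    unfolding FactRing_def A_RCOSETS_def' by auto
  have q_eq: "a \<in> J \<Longrightarrow> ?q a = J" for a
    using a_rcos_zero[OF J] by blast
  note M = quotient_module_simps(1-3)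
  have smult: "x \<odot>\<^bsub>?M\<^esub> ?q a = ?q (x \<otimes> a)" if "x \<in> carrier R" "a \<in> carrier R" for x a
    unfolding quotient_module_simps using that by (rule q.hom_mult[symmetric])
  have "(\<exists>N. (\<forall>i\<le>n. submodule (N i) R ?M) \<and> (\<forall>i<n. N i \<subset> N (Suc i))) \<longleftrightarrow>
        (\<exists>L. (\<forall>i\<le>n. ideal (L i) R \<and> J \<subseteq> L i) \<and> (\<forall>i<n. L i \<subset> L (Suc i)))" for n :: nat
  proof safe
    fix N :: "nat \<Rightarrow> 'a set set" assume N: "\<forall>i\<le>n. submodule (N i) R ?M" "\<forall>i<n. N i \<subset> N (Suc i)"
    define L where "L i = {r \<in> carrier R. ?q r \<in> N i}" for i
    have sub: "N i \<subseteq> carrier ?M" if "i \<le> n" for i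
      using N(1) that subgroup.subset[of "N i" "add_monoid ?M"] by (auto simp: submodule_def)
    have "ideal (L i) R \<and> J \<subseteq> L i" if "i \<le> n" for i
    proof
      interpret N: submodule "N i" R ?M using N(1) that by blast
      have zero: "J \<in> N i" using N.one_closed by (simp add: M)
      show "J \<subseteq> L i" using zero J.Icarr by (auto simp: L_def q_eq)
      have add: "a \<oplus> b \<in> L i" if "a \<in> L i" "b \<in> L i" for a b
        using that N.m_closed[of "?q a" "?q b"] by (simp add: L_def M)
      have mult: "x \<otimes> a \<in> L i" if "a \<in> L i" "x \<in> carrier R" for a x
        using that N.smult_closed[of x "?q a"] by (simp add: L_def smult)
      show "ideal (L i) R"
      proof (rule idealI)
        show "subgroup (L i) (add_monoid R)"
        proof (rule add.subgroupI)
          show "\<ominus> a \<in> L i" if "a \<in> L i" for a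
            using mult[OF that, of "\<ominus> \<one>"] that by (auto simp: l_minus L_def)
          show "L i \<subseteq> carrier R" by (auto simp: L_def)
          show "L i \<noteq> {}" using \<open>J \<subseteq> L i\<close> J.zero_closed by blast
        qed (rule add)
        show "a \<otimes> x \<in> L i" if "a \<in> L i" "x \<in> carrier R" for a x
          using mult[OF that] that by (simp add: L_def m_comm)
      qed (use mult ring_axioms in auto)
    qed
    moreover have "L i \<subset> L (Suc i)" if i: "i < n" for i
    proof
      show "L i \<subseteq> L (Suc i)" using N(2) i by (auto simp: L_def)
      obtain x where x: "x \<in> N (Suc i)" "x \<notin> N i"
        using psubset_imp_ex_mem[OF N(2)[rule_format, OF i]] by auto
      then obtain r where "r \<in> carrier R" "x = ?q r"
        using sub[of "Suc i"] i by (auto simp: M carrier)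
      then have "r \<in> L (Suc i)" "r \<notin> L i" using x by (auto simp: L_def)
      then show "L i \<noteq> L (Suc i)" by blast
    qed
    ultimately show "\<exists>L. (\<forall>i\<le>n. ideal (L i) R \<and> J \<subseteq> L i) \<and> (\<forall>i<n. L i \<subset> L (Suc i))"
      by (intro exI[of _ L] conjI allI impI) simp_all
  next
    fix L :: "nat \<Rightarrow> 'a set"
    assume L: "\<forall>i\<le>n. ideal (L i) R \<and> J \<subseteq> L i" "\<forall>i<n. L i \<subset> L (Suc i)"
    have "submodule (?q ` L i) R ?M" if "i \<le> n" for i
    proof -
      interpret L: ideal "L i" R using L(1) that by blast
      interpret qL: ideal "?q ` L i" "R Quot J"
        by (rule ring_ideal_imp_quot_ideal[OF J L.ideal_axioms])
      show ?thesis
      proof (intro submodule.intro submodule_axioms.intro)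
        show "subgroup (?q ` L i) (add_monoid ?M)"
          unfolding subgroup_add_monoid_quotient_module by (rule qL.a_subgroup)
        show "a \<odot>\<^bsub>?M\<^esub> x \<in> ?q ` L i" if "a \<in> carrier R" "x \<in> ?q ` L i" for a x
        proof -
          obtain r where r: "r \<in> L i" "x = ?q r" using \<open>x \<in> ?q ` L i\<close> by blast
          have "a \<odot>\<^bsub>?M\<^esub> x = ?q (a \<otimes> r)"
            unfolding r(2) by (rule smult[OF \<open>a \<in> carrier R\<close> L.Icarr[OF r(1)]])
          then show ?thesis using L.I_l_closed[OF r(1) \<open>a \<in> carrier R\<close>] by simp
        qed
      qed
    qed
    moreover have "?q ` L i \<subset> ?q ` L (Suc i)" if i: "i < n" for i
    proof
      show "?q ` L i \<subseteq> ?q ` L (Suc i)" using L(2) i by blast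
      interpret L: ideal "L i" R using L(1) i by simp
      interpret L': ideal "L (Suc i)" R using L(1) i by simp
      obtain x where x: "x \<in> L (Suc i)" "x \<notin> L i"
        using psubset_imp_ex_mem[OF L(2)[rule_format, OF i]] by auto
      \<comment> \<open>Images stay distinct because \<open>L i\<close> contains the kernel
        \<open>J\<close>: two elements with the same class differ by an element of
        \<open>L i\<close>.\<close>
      have "?q x \<notin> ?q ` L i"
      proof
        assume "?q x \<in> ?q ` L i"
        then obtain y where y: "y \<in> L i" "?q x = ?q y" by blast
        have c: "x \<in> carrier R" "y \<in> carrier R" using x y L'.Icarr L.Icarr by auto
        then have "x \<ominus> y \<in> J" using quotient_eq_iff_same_a_r_cos[OF J] y by blast
        then have "x \<ominus> y \<in> L i" using L(1) i by (meson less_imp_le subsetD)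
        then have "(x \<ominus> y) \<oplus> y \<in> L i" using y L.a_closed by blast
        moreover have "(x \<ominus> y) \<oplus> y = x"
          using c by (simp add: a_minus_def a_assoc l_neg)
        ultimately show False using x by simp
      qed
      then show "?q ` L i \<noteq> ?q ` L (Suc i)" using x by blast
    qed
    ultimately show "\<exists>N. (\<forall>i\<le>n. submodule (N i) R ?M) \<and> (\<forall>i<n. N i \<subset> N (Suc i))"
      by (intro exI[of _ "\<lambda>i. ?q ` L i"] conjI allI impI)
  qed
  then show ?thesis by (simp add: quotient_length_def module_length_def)
qed

lemma (in cring) quotient_length_eqI:
  assumes "ideal J R"
    and "\<And>L n. (\<And>i. i \<le> n \<Longrightarrow> ideal (L i) R) \<Longrightarrow> (\<And>i. i \<le> n \<Longrightarrow> J \<subseteq> L i) \<Longrightarrow>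
      (\<And>i. i < n \<Longrightarrow> L i \<subset> L (Suc i)) \<Longrightarrow> n \<le> c"
    and "\<And>i. i \<le> c \<Longrightarrow> ideal (L i) R" and "\<And>i. i \<le> c \<Longrightarrow> J \<subseteq> L i"
    and "\<And>i. i < c \<Longrightarrow> L i \<subset> L (Suc i)"
  shows "quotient_length R J = enat c"
  unfolding quotient_length_eq_Sup[OF assms(1)]
proof (rule antisym)
  show "Sup {enat n | n. \<exists>L. (\<forall>i\<le>n. ideal (L i) R \<and> J \<subseteq> L i) \<and> (\<forall>i<n. L i \<subset> L (Suc i))} \<le> enat c"
  proof (rule Sup_least)
    fix x assume "x \<in> {enat n | n. \<exists>L. (\<forall>i\<le>n. ideal (L i) R \<and> J \<subseteq> L i) \<and> (\<forall>i<n. L i \<subset> L (Suc i))}"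
    then obtain n L where "x = enat n" "\<forall>i\<le>n. ideal (L i) R \<and> J \<subseteq> L i" "\<forall>i<n. L i \<subset> L (Suc i)"
      by blast
    then show "x \<le> enat c" using assms(2)[of n L] by simp
  qed
  show "enat c \<le> Sup {enat n | n. \<exists>L. (\<forall>i\<le>n. ideal (L i) R \<and> J \<subseteq> L i) \<and> (\<forall>i<n. L i \<subset> L (Suc i))}"
    using assms(3-5) by (intro Sup_upper) blast
qed

lemma (in cring) quotient_length_infinite:
  assumes "ideal J R"
    and "\<And>n. \<exists>L. (\<forall>i\<le>n. ideal (L i) R \<and> J \<subseteq> L i) \<and> (\<forall>i<n. L i \<subset> L (Suc i))"
  shows "quotient_length R J = \<infinity>"
proof -
  have "enat n \<le> quotient_length R J" for n
    unfolding quotient_length_eq_Sup[OF assms(1)] by (rule Sup_upper) (use assms(2)[of n] in blast)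
  from this[of "Suc (the_enat (quotient_length R J))"] show ?thesis
    by (cases "quotient_length R J") simp_all
qed

context stanley_reisner
begin

section \<open>Graded components and the maximal homogeneous ideal\<close>

lemma sr_component_eq:
  "sr_component v \<Delta> j = {a \<in> carrier R. \<forall>m\<in>supp (nf a). mdeg m = j}"
proof safe
  fix a assume "a \<in> (sr_component v \<Delta> j :: 'k mpoly set set)"
  then obtain f :: "'k mpoly" where f: "f \<in> carrier S" "homogeneous j f" "a = \<pi> f"
    by (auto simp: sr_component_def)
  then show "a \<in> carrier R" by (simp add: sr_class_closed)
  show "mdeg m = j" if "m \<in> supp (nf a)" for m
    using f that by (simp add: nf_sr_class supp_filt homogeneous_def mdeg_def)
next
  fix a assume a: "a \<in> carrier R" "\<forall>m\<in>supp (nf a). mdeg m = j"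
  then have "a = \<pi> (nf a)" "nf a \<in> carrier S" "homogeneous j (nf a)"
    by (simp_all add: nf_face(2-4) homogeneous_def mdeg_def)
  then show "a \<in> sr_component v \<Delta> j" unfolding sr_component_def by blast
qed

lemma homogeneous_ideal_D: "homogeneous_ideal (D 1) R (sr_component v \<Delta>)"
  unfolding homogeneous_ideal_def
proof (intro conjI ideal_D antisym)
  let ?G = "D 1 \<inter> (\<Union>j. sr_component v \<Delta> j)"
  have carr: "?G \<subseteq> carrier R" by (auto simp: D_def)
  show "Idl ?G \<subseteq> D 1" by (rule R.genideal_minimal[OF ideal_D]) simp
  interpret G: ideal "Idl ?G" R by (rule R.genideal_ideal[OF carr])
  show "D 1 \<subseteq> Idl ?G"
  proof
    fix x assume "x \<in> D 1"
    then show "x \<in> Idl ?G"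
    proof (induction x rule: D_induct)
      case (single m c)
      then have "\<pi> (Poly_Mapping.single m c) \<in> D 1" by (rule sr_class_mon_D)
      moreover have "\<pi> (Poly_Mapping.single m c) \<in> sr_component v \<Delta> (mdeg m)"
        using single by (simp add: sr_component_eq sr_class_closed mon_closed nf_sr_class supp_filt)
      ultimately show ?case by (intro subsetD[OF R.genideal_self[OF carr]]) blast
    qed (use G.a_closed G.zero_closed in blast)+
  qed
qed

text \<open>A homogeneous element outside \<open>D 1\<close> has a monomial of degree 0, hence is a
  nonzero constant and so a unit. A proper homogeneous ideal therefore lies in \<open>D 1\<close>,
  which is itself homogeneous and proper, and maximality gives equality.\<close>

lemma maximal_homogeneous_ideal_eq:
  assumes "maximal_homogeneous_ideal M R (sr_component v \<Delta>)"
  shows "M = D 1"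
proof -
  let ?gr = "sr_component v \<Delta> :: nat \<Rightarrow> _"
  have M: "ideal M R" "M = Idl (M \<inter> (\<Union>j. ?gr j))" "M \<noteq> carrier R"
    and max: "\<And>J. homogeneous_ideal J R ?gr \<Longrightarrow> M \<subseteq> J \<Longrightarrow> J = M \<or> J = carrier R"
    using assms by (auto simp: maximal_homogeneous_ideal_def homogeneous_ideal_def)
  interpret M: ideal M R by (rule M(1))
  have "M \<inter> (\<Union>j. ?gr j) \<subseteq> D 1"
  proof safe
    fix a j assume a: "a \<in> M" "a \<in> ?gr j"
    have carr: "a \<in> carrier R" and hom: "\<forall>m\<in>supp (nf a). mdeg m = j"
      using a by (auto simp: sr_component_eq)
    show "a \<in> D 1"
    proof (rule ccontr)
      assume "a \<notin> D 1"
      then obtain m where m: "m \<in> supp (nf a)" "mdeg m = 0"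
        using carr by (auto simp: D_def low_def not_less_eq_eq)
      then have sub: "supp (nf a) \<subseteq> {0}" "0 \<in> supp (nf a)" using hom by auto
      define c where "c = coef (nf a) 0"
      have c: "c \<noteq> 0" using sub by (simp add: c_def in_keys_iff)
      have "nf a = Poly_Mapping.single 0 c"
        using sub by (intro poly_mapping_eqI) (auto simp: c_def lookup_single when_def in_keys_iff)
      then have "\<pi> (Poly_Mapping.single 0 (inverse c)) \<otimes> a
          = \<pi> (Poly_Mapping.single 0 (inverse c)) \<otimes> \<pi> (Poly_Mapping.single 0 c)"
        using carr nf_face(4) by metis
      also have "\<dots> = \<one>"
        using c by (simp add: mon_closed empty_face mult_single sr_class_one flip: sr_class_mult)
      finally have "\<one> \<in> M"
        using M.I_l_closed[OF a(1), of "\<pi> (Poly_Mapping.single 0 (inverse c))"]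
        by (simp add: sr_class_closed mon_closed empty_face)
      then show False using M(3) M.one_imp_carrier by blast
    qed
  qed
  then have "M \<subseteq> D 1"
    by (subst M(2)) (rule R.genideal_minimal[OF ideal_D])
  moreover have "\<one> \<notin> D 1" by (simp add: D_def low_def)
  ultimately show ?thesis using max[OF homogeneous_ideal_D] by auto
qed


subsection \<open>Ideals that agree with a power of the maximal ideal on every face\<close>

text \<open>\<open>A\<close> lies in \<mm>^k and has the same image as \<mm>^k on every face. The
  element \<open>y\<close> may depend on the face, so \<open>A\<close> can be strictly smaller than
  \<mm>^k.\<close>

definition facewise_full :: "nat \<Rightarrow> 'k mpoly set set \<Rightarrow> bool" where
  "facewise_full k A \<longleftrightarrow> ideal A R \<and> A \<subseteq> D k \<and> (\<forall>F\<in>\<Delta>. \<forall>x\<in>D k. \<exists>y\<in>A. rs F y = rs F x)"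

lemma facewise_full_carrier: "facewise_full 0 (carrier R)"
  by (auto simp: facewise_full_def D_0 R.oneideal)

text \<open>On a fixed face the restriction is multiplicative and \<mm>^(k+l) is generated by
  products from \<mm>^k and \<mm>^l, so substitutes can be chosen factor by factor.\<close>

lemma facewise_full_mult:
  assumes A: "facewise_full k A" and B: "facewise_full l B"
  shows "facewise_full (k + l) (ideal_prod R A B)"
proof -
  have id: "ideal A R" "ideal B R" using A B by (auto simp: facewise_full_def)
  interpret P: ideal "ideal_prod R A B" R by (rule R.ideal_prod_is_ideal[OF id])
  have "x \<in> D (k + l)" if "x \<in> ideal_prod R A B" for x
    using that
  proof induction
    case (prod a b)
    then show ?case using A B by (auto simp: facewise_full_def intro: D_mult)
  next
    case (sum a b)
    then show ?case by (intro additive_subgroup.a_closed[OF ideal.axioms(1)[OF ideal_D]])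
  qed
  moreover have "\<exists>y\<in>ideal_prod R A B. rs F y = rs F x" if F: "F \<in> \<Delta>" and x: "x \<in> D (k + l)" for F x
  proof -
    from x have "x \<in> ideal_prod R (D k) (D l)" by (simp add: D_prod)
    then show ?thesis
    proof induction
      case (prod a b)
      obtain a' where a': "a' \<in> A" "rs F a' = rs F a"
        using A F prod unfolding facewise_full_def by blast
      obtain b' where b': "b' \<in> B" "rs F b' = rs F b"
        using B F prod unfolding facewise_full_def by blast
      have "a \<in> carrier R" "b \<in> carrier R" "a' \<in> carrier R" "b' \<in> carrier R"
        using prod subsetD[OF D_carrier] ideal.Icarr[OF id(1) a'(1)] ideal.Icarr[OF id(2) b'(1)] by auto
      then have "rs F (a' \<otimes> b') = rs F (a \<otimes> b)" using a' b' F by (simp add: rs_mult)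
      then show ?case
        by (rule bexI[OF _ ideal_prod.prod[OF a'(1) b'(1)]])
    next
      case (sum a b)
      then obtain a' b' where ab': "a' \<in> ideal_prod R A B" "b' \<in> ideal_prod R A B"
        "rs F a' = rs F a" "rs F b' = rs F b" by blast
      moreover have "a \<in> carrier R" "b \<in> carrier R"
        using sum.hyps(1,2) subsetD[OF D_carrier] unfolding D_prod by auto
      ultimately have "rs F (a' \<oplus> b') = rs F (a \<oplus> b)"
        by (simp add: rs_add P.Icarr)
      then show ?case
        by (rule bexI[OF _ P.a_closed[OF ab'(1,2)]])
    qed
  qed
  ultimately show ?thesis by (auto simp: facewise_full_def P.ideal_axioms)
qed

lemma facewise_full_pow:
  assumes "facewise_full k A"
  shows "facewise_full (n * k) (A [^]\<^bsub>ideals_set R\<^esub> (n::nat))"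
proof (induction n)
  case 0
  show ?case by (simp add: ideals_set_simps facewise_full_carrier)
next
  case (Suc n)
  have "A [^]\<^bsub>ideals_set R\<^esub> Suc n = ideal_prod R (A [^]\<^bsub>ideals_set R\<^esub> n) A"
    by (simp add: ideals_set_simps(1))
  moreover have "Suc n * k = n * k + k" by simp
  ultimately show ?case using facewise_full_mult[OF Suc assms] by (simp only:)
qed

lemma facewise_full_finprod:
  assumes "finite B" "\<And>i. i \<in> B \<Longrightarrow> facewise_full (k i) (A i)"
  shows "facewise_full (\<Sum>i\<in>B. k i) (finprod (ideals_set R) A B)"
  using assms
proof (induction B rule: finite_induct)
  case empty
  show ?case by (simp add: ideals_set_simps facewise_full_carrier)
next
  case (insert i B)
  have "finprod (ideals_set R) A (insert i B) = ideal_prod R (A i) (finprod (ideals_set R) A B)"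
    using insert by (subst ideals.finprod_insert)
      (auto simp: ideals_set_simps facewise_full_def)
  moreover have "facewise_full (k i + (\<Sum>i\<in>B. k i)) (ideal_prod R (A i) (finprod (ideals_set R) A B))"
    by (rule facewise_full_mult) (use insert in \<open>simp_all only: insert_iff simp_thms\<close>)
  ultimately show ?case using sum.insert[OF insert.hyps, of k] by (simp only:)
qed

section \<open>Ideals generated by linear systems of parameters\<close>

lemma mdeg_eq_1:
  assumes "mdeg m = 1"
  obtains i where "m = Poly_Mapping.single i 1"
proof -
  have "m \<noteq> 0" using assms by auto
  then obtain i where "i \<in> supp m" using supp_empty_iff by fastforce
  then obtain n where n: "m = Poly_Mapping.single i 1 + n" by (rule monomial_split_var)
  then have "n = 0" using assms by simp
  then show thesis using n that by simp
qed

text \<open>If the variable were missed, the ideal would vanish along a whole line through the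
  origin in the coordinate space of \<open>F\<close>, and the quotient would have infinite
  length.\<close>

lemma linear_sop_spans_face:
  assumes sop: "linear_sop R (sr_component v \<Delta>) \<theta>" and F: "F \<in> \<Delta>" and i: "i \<in> F"
  shows "\<exists>y\<in>Idl (set \<theta>). rs F y = var_poly i"
proof (rule ccontr)
  assume not: "\<not> ?thesis"
  let ?I = "Idl (set \<theta>)"
  have \<theta>: "set \<theta> \<subseteq> sr_component v \<Delta> 1" and fin: "quotient_length R ?I < \<infinity>"
    using sop by (auto simp: linear_sop_def)
  have carr: "set \<theta> \<subseteq> carrier R" using \<theta> by (auto simp: sr_component_eq)
  interpret I: ideal ?I R by (rule R.genideal_ideal[OF carr])
  \<comment> \<open>The image of the entire ideal, and not only of \<open>\<theta>\<close>, is
    taken: it is a vector space that contains the restricted parameters, and the missing variable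
    lies outside it.\<close>
  define U where "U = rs F ` ?I"
  have U0: "0 \<in> U" unfolding U_def using I.zero_closed rs_zero by (metis image_eqI)
  have U_add: "f + g \<in> U" if fg: "f \<in> U" "g \<in> U" for f g
  proof -
    obtain a b where ab: "a \<in> ?I" "b \<in> ?I" "f = rs F a" "g = rs F b" using fg by (auto simp: U_def)
    then have "f + g = rs F (a \<oplus> b)" by (simp add: rs_add I.Icarr)
    then show ?thesis using ab I.a_closed by (auto simp: U_def)
  qed
  have U_scale: "const_poly c * f \<in> U" if f: "f \<in> U" for c f
  proof -
    obtain a where a: "a \<in> ?I" "f = rs F a" using f by (auto simp: U_def)
    have c: "const_poly c \<in> carrier S" "restr F (const_poly c) = const_poly c"
      by (auto simp: const_poly_def mon_closed empty_face filt_single)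
    then have "const_poly c * f = rs F (\<pi> (const_poly c) \<otimes> a)"
      using a F by (simp add: rs_mult rs_sr_class sr_class_closed I.Icarr)
    then show ?thesis using a c I.I_l_closed sr_class_closed by (auto simp: U_def)
  qed
  have U_not: "var_poly i \<notin> U" using not by (auto simp: U_def)
  obtain \<phi> :: "'k mpoly \<Rightarrow> 'k"
    where \<phi>_add: "\<And>f g. \<phi> (f + g) = \<phi> f + \<phi> g"
      and scale: "\<And>c f. \<phi> (const_poly c * f) = c * \<phi> f"
      and \<phi>_zero: "\<And>f. f \<in> U \<Longrightarrow> \<phi> f = 0" and one: "\<phi> (var_poly i) = 1"
    using exists_functional[OF U0 U_add U_scale U_not] by blast
  \<comment> \<open>The direction of the line; its coordinate at \<open>i\<close> is 1, so the line
    is not degenerate.\<close>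
  define w where "w j = \<phi> (var_poly j)" for j
  define \<psi> where "\<psi> a = line_eval w (rs F a)" for a
  have \<psi>: "\<psi> (a \<otimes> b) = \<psi> a * \<psi> b" "\<psi> (a \<oplus> b) = \<psi> a + \<psi> b"
    if "a \<in> carrier R" "b \<in> carrier R" for a b
    using that F by (simp_all add: \<psi>_def rs_mult rs_add line_eval_mult line_eval_add)
  \<comment> \<open>The functional is only linear whereas evaluation is multiplicative; they can be
    compared in degree 1, which is where the parameters live.\<close>
  have linear: "line_eval w f = Polynomial.monom (\<phi> f) 1" if "\<forall>m\<in>supp f. mdeg m = 1" for f
    using that
  proof (induction f rule: mpoly_induct)
    case zero
    show ?case using \<phi>_zero[OF U0] by simp
  next
    case (single m c)
    then obtain j where j: "m = Poly_Mapping.single j 1" using mdeg_eq_1 by blast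
    then have "Poly_Mapping.single m c = const_poly c * var_poly j"
      by (simp add: const_poly_def var_poly_def mult_single)
    then have "\<phi> (Poly_Mapping.single m c) = c * w j" by (simp add: scale w_def)
    then show ?case by (simp add: line_eval_single j mon_eval_def)
  next
    case (add f g)
    then show ?case by (simp add: line_eval_add \<phi>_add add_monom)
  qed
  have \<psi>_\<theta>: "\<psi> a = 0" if a: "a \<in> set \<theta>" for a
  proof -
    have "\<forall>m\<in>supp (rs F a). mdeg m = 1" using \<theta> a by (auto simp: sr_component_eq rs_def supp_filt)
    moreover have "rs F a \<in> U" using a R.genideal_self[OF carr] by (auto simp: U_def)
    ultimately show ?thesis unfolding \<psi>_def by (simp add: linear \<phi>_zero)
  qed
  define x where "x = \<pi> (var_poly i)"
  have var: "var_poly i \<in> carrier S" "restr F (var_poly i) = (var_poly i :: 'k mpoly)"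
    using F i subface[OF F, of "{i}"] by (auto simp: var_poly_def mon_closed filt_single)
  have x: "x \<in> carrier R" "rs F x = var_poly i"
    using F var by (auto simp: x_def sr_class_closed rs_sr_class)
  have \<psi>_x: "\<psi> (x [^] n) = Polynomial.monom 1 n" for n :: nat
  proof -
    have "line_eval w (var_poly i) = Polynomial.monom (\<phi> (var_poly i)) 1"
      by (rule linear) (simp add: var_poly_def)
    then show ?thesis
      using F x by (simp add: \<psi>_def rs_pow line_eval_power one monom_power)
  qed
  \<comment> \<open>The preimage of the ideal generated by t^N in the polynomial ring of the line.
    All these ideals contain \<open>?I\<close>, on which the evaluation vanishes, and powers of
    \<open>x\<close> map to powers of t and separate them.\<close>
  define L where "L N = {a \<in> carrier R. Polynomial.monom 1 N dvd \<psi> a}" for N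
  have idL: "ideal (L N) R" for N
    by (rule ideal_R_I) (auto simp: L_def \<psi>, auto simp: \<psi>_def)
  have IL: "?I \<subseteq> L N" for N
    using carr by (intro R.genideal_minimal[OF idL]) (auto simp: L_def \<psi>_\<theta>)
  have strict: "L (Suc N) \<subset> L N" for N
  proof
    have "Polynomial.monom (1::'k) N dvd Polynomial.monom 1 (Suc N)"
      by (metis dvd_triv_left mult_1 mult_monom plus_1_eq_Suc add.commute)
    then show "L (Suc N) \<subseteq> L N" by (auto simp: L_def intro: dvd_trans)
    have "\<not> Polynomial.monom (1::'k) (Suc N) dvd Polynomial.monom 1 N"
    proof
      assume "Polynomial.monom (1::'k) (Suc N) dvd Polynomial.monom 1 N"
      then have "Polynomial.degree (Polynomial.monom (1::'k) (Suc N)) \<le> Polynomial.degree (Polynomial.monom (1::'k) N)"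
        by (rule dvd_imp_degree_le) simp
      then show False by (simp add: degree_monom_eq)
    qed
    then have "x [^] N \<in> L N" "x [^] N \<notin> L (Suc N)" using x by (auto simp: L_def \<psi>_x)
    then show "L (Suc N) \<noteq> L N" by blast
  qed
  have "\<exists>L. (\<forall>i\<le>n. ideal (L i) R \<and> ?I \<subseteq> L i) \<and> (\<forall>i<n. L i \<subset> L (Suc i))" for n :: nat
  \<comment> \<open>Chains are required to ascend while \<open>L\<close> descends, hence the
    reversal.\<close>
  proof (intro exI[of _ "\<lambda>j. L (n - j)"] conjI allI impI idL IL)
    fix j assume "j < n"
    then show "L (n - j) \<subset> L (n - Suc j)" using strict[of "n - Suc j"] by (simp add: Suc_diff_Suc)
  qed
  then have "quotient_length R ?I = \<infinity>"
    by (rule R.quotient_length_infinite[OF I.ideal_axioms])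
  then show False using fin by simp
qed

text \<open>A monomial of positive degree supported in \<open>F\<close> is a multiple of a variable
  of \<open>F\<close>, which is the restriction of an element of the ideal. The other monomials
  restrict to 0.\<close>

lemma facewise_full_linear_sop:
  assumes sop: "linear_sop R (sr_component v \<Delta>) \<theta>"
  shows "facewise_full 1 (Idl (set \<theta>))"
  unfolding facewise_full_def
proof (intro conjI ballI)
  have \<theta>: "set \<theta> \<subseteq> D 1"
    using sop by (auto simp: linear_sop_def sr_component_eq D_def low_def)
  then have carr: "set \<theta> \<subseteq> carrier R" using D_carrier by blast
  show I: "ideal (Idl (set \<theta>)) R" by (rule R.genideal_ideal[OF carr])
  interpret I: ideal "Idl (set \<theta>)" R by (rule I)
  show "Idl (set \<theta>) \<subseteq> D 1" by (rule R.genideal_minimal[OF ideal_D \<theta>])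
  fix F x assume F: "F \<in> \<Delta>" and "x \<in> D 1"
  from \<open>x \<in> D 1\<close> show "\<exists>y\<in>Idl (set \<theta>). rs F y = rs F x"
  proof (induction x rule: D_induct)
    case (single m c)
    have rs: "rs F (\<pi> (Poly_Mapping.single m c)) = (Poly_Mapping.single m c when supp m \<subseteq> F)"
      using F single by (simp add: rs_sr_class mon_closed filt_single)
    show ?case
    proof (cases "supp m \<subseteq> F")
      case True
      have "m \<noteq> 0" using single by auto
      then obtain i where i: "i \<in> supp m" using supp_empty_iff by fastforce
      then obtain n where n: "m = Poly_Mapping.single i 1 + n" by (rule monomial_split_var)
      obtain y where y: "y \<in> Idl (set \<theta>)" "rs F y = var_poly i"
        using linear_sop_spans_face[OF sop F] i True by blast
      have supp: "supp n \<subseteq> supp m" unfolding n supp_add_nat by (rule Un_upper2)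
      have face: "face n" "supp n \<subseteq> F" using subface[OF single(1) supp] supp True by auto
      have "rs F (\<pi> (Poly_Mapping.single n c) \<otimes> y) = Poly_Mapping.single n c * var_poly i"
        using F y face by (simp add: rs_mult rs_sr_class sr_class_closed mon_closed I.Icarr filt_single)
      also have "\<dots> = Poly_Mapping.single m c"
        by (simp add: var_poly_def mult_single n add.commute)
      finally show ?thesis
        using y face by (intro bexI[of _ "\<pi> (Poly_Mapping.single n c) \<otimes> y"])
          (auto simp: rs True intro!: I.I_l_closed sr_class_closed mon_closed)
    next
      case False
      then show ?thesis using rs I.zero_closed by (intro bexI[of _ \<zero>]) auto
    qed
  next
    case (add a b)
    then obtain a' b' where "a' \<in> Idl (set \<theta>)" "b' \<in> Idl (set \<theta>)" "rs F a' = rs F a" "rs F b' = rs F b"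
      by blast
    then show ?case
      using add by (intro bexI[of _ "a' \<oplus> b'"]) (simp_all add: rs_add I.Icarr)
  next
    case zero
    show ?case using I.zero_closed by blast
  qed
qed

end

context stanley_reisner
begin

subsection \<open>Minimal primes\<close>

definition face_kernel :: "nat set \<Rightarrow> 'k mpoly set set" where
  "face_kernel F = {a \<in> carrier R. rs F a = 0}"

lemma primeideal_face_kernel:
  assumes "F \<in> \<Delta>"
  shows "primeideal (face_kernel F) R"
proof (rule primeidealI)
  show "ideal (face_kernel F) R"
    using assms by (intro ideal_R_I) (auto simp: face_kernel_def rs_add rs_mult)
  have "\<one> \<notin> face_kernel F" by (simp add: face_kernel_def)
  then show "carrier R \<noteq> face_kernel F" using R.one_closed by blast
  show "a \<in> face_kernel F \<or> b \<in> face_kernel F"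
    if "a \<in> carrier R" "b \<in> carrier R" "a \<otimes> b \<in> face_kernel F" for a b
    using that assms by (simp add: face_kernel_def rs_mult)
qed (rule R.is_cring)

text \<open>If a prime missed all these kernels, take from each an element outside \<open>P\<close>.
  Their product vanishes on every facet, so it is zero, yet it lies outside
  \<open>P\<close>.\<close>

lemma prime_contains_face_kernel:
  assumes "primeideal P R"
  obtains F where "F \<in> facets" "face_kernel F \<subseteq> P"
proof -
  interpret P: primeideal P R by (rule assms)
  have one: "\<one> \<notin> P" using P.one_imp_carrier P.I_notcarr by auto
  have "\<exists>F\<in>facets. face_kernel F \<subseteq> P"
  proof (rule ccontr)
    assume "\<not> (\<exists>F\<in>facets. face_kernel F \<subseteq> P)"
    then have ex: "\<exists>a. a \<in> face_kernel F \<and> a \<notin> P" if "F \<in> facets" for F using that by auto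
    have "\<exists>b. b \<in> carrier R \<and> b \<notin> P \<and> (\<forall>F\<in>\<Phi>. rs F b = 0)" if "finite \<Phi>" "\<Phi> \<subseteq> facets" for \<Phi>
      using that
    proof (induction \<Phi> rule: finite_induct)
      case empty
      show ?case using one by (intro exI[of _ \<one>]) simp
    next
      case (insert F \<Phi>)
      then obtain b where b: "b \<in> carrier R" "b \<notin> P" "\<forall>F\<in>\<Phi>. rs F b = 0" by auto
      obtain a where a: "a \<in> carrier R" "rs F a = 0" "a \<notin> P"
        using ex[of F] insert.prems by (auto simp: face_kernel_def)
      have "rs G (b \<otimes> a) = 0" if "G \<in> insert F \<Phi>" for G
        using that insert.prems a b by (auto simp: rs_mult facet_face)
      moreover have "b \<otimes> a \<notin> P" using a b P.I_prime by blast
      ultimately show ?case using a b by (intro exI[of _ "b \<otimes> a"]) simp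
    qed
    moreover have "finite facets" using finite_complex by (simp add: facets_def)
    ultimately obtain b where b: "b \<in> carrier R" "b \<notin> P" "\<forall>F\<in>facets. rs F b = 0" by blast
    then have "b = \<zero>" by (intro eq_by_facets) simp_all
    then show False using b P.zero_closed by simp
  qed
  then show thesis using that by blast
qed

text \<open>Tested on variables: that of \<open>i\<close> lies in the kernel for \<open>G\<close>
  precisely when \<open>i\<close> is not in \<open>G\<close>. Hence the kernels of distinct facets
  are incomparable.\<close>

lemma face_kernel_mono_imp:
  assumes "F \<in> \<Delta>" "G \<in> \<Delta>" "face_kernel G \<subseteq> face_kernel F"
  shows "F \<subseteq> G"
proof
  fix i assume i: "i \<in> F"
  let ?x = "\<pi> (var_poly i)"
  have c: "var_poly i \<in> carrier S"
    using subface[OF assms(1), of "{i}"] i by (simp add: var_poly_def mon_closed)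
  then have "rs F ?x \<noteq> 0"
    using i assms by (simp add: rs_sr_class var_poly_def filt_single single_zero) (metis lookup_single_eq lookup_zero one_neq_zero)
  then have "?x \<notin> face_kernel G" using assms(3) by (auto simp: face_kernel_def)
  then have "rs G ?x \<noteq> 0" using c by (simp add: face_kernel_def sr_class_closed)
  then show "i \<in> G"
    using assms c by (auto simp: rs_sr_class var_poly_def filt_single when_def split: if_splits)
qed

lemma minimal_prime_iff: "minimal_prime P R \<longleftrightarrow> (\<exists>F\<in>facets. P = face_kernel F)"
proof
  assume P: "minimal_prime P R"
  then obtain F where F: "F \<in> facets" "face_kernel F \<subseteq> P"
    using prime_contains_face_kernel by (auto simp: minimal_prime_def)
  then have "face_kernel F = P"
    using P primeideal_face_kernel facet_face by (auto simp: minimal_prime_def)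
  then show "\<exists>F\<in>facets. P = face_kernel F" using F by blast
next
  assume "\<exists>F\<in>facets. P = face_kernel F"
  then obtain F where F: "F \<in> facets" and P: "P = face_kernel F" by blast
  have "Q = P" if Q: "primeideal Q R" "Q \<subseteq> P" for Q
  proof -
    obtain G where G: "G \<in> facets" "face_kernel G \<subseteq> Q"
      using Q prime_contains_face_kernel by blast
    then have "F \<subseteq> G" using face_kernel_mono_imp[of F G] F Q P facet_face by blast
    then have "F = G" using F G by (auto simp: facets_def)
    then show ?thesis using G P Q by blast
  qed
  then show "minimal_prime P R"
    using F P primeideal_face_kernel facet_face by (simp add: minimal_prime_def)
qed


subsection \<open>Tight closure\<close>

lemma frobenius_power_D:
  assumes "A \<subseteq> D k"
  shows "frobenius_power R A q \<subseteq> D (q * k)"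
  unfolding frobenius_power_def
  by (rule R.genideal_minimal[OF ideal_D]) (use assms D_pow in auto)

lemma tight_closure_subset:
  assumes p: "p \<ge> 2" and A: "A \<subseteq> D k"
  shows "tight_closure R p A \<subseteq> D k"
proof
  fix x assume "x \<in> tight_closure R p A"
  then obtain c where x: "x \<in> carrier R" and c: "c \<in> carrier R" "\<And>P. minimal_prime P R \<Longrightarrow> c \<notin> P"
    and ev: "\<forall>\<^sub>F e in sequentially. c \<otimes> x [^] (p ^ e) \<in> frobenius_power R A (p ^ e)"
    by (auto simp: tight_closure_def)
  show "x \<in> D k"
  proof (rule ccontr)
    assume "x \<notin> D k"
    then obtain m where m: "m \<in> supp (nf x)" "mdeg m < k"
      using x by (auto simp: D_def low_def not_le)
    \<comment> \<open>On a facet through the offending monomial the restriction of \<open>x\<close>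
      still has order below \<open>k\<close>.\<close>
    then obtain F where F: "F \<in> facets" "supp m \<subseteq> F" using nf_face(1)[OF x] ex_facet by metis
    note F\<Delta> = facet_face[OF F(1)]
    define f g where "f = rs F x" and "g = rs F c"
    have mf: "m \<in> supp f" using m F by (simp add: f_def rs_def supp_filt)
    then have f: "f \<noteq> 0" by auto
    have "\<not> low k f" using mf m(2) unfolding low_def by (metis not_le)
    then have ord_f: "ord f < k" using low_iff_ord[OF f] by simp
    \<comment> \<open>Avoiding minimal primes means that \<open>c\<close> stays nonzero on every
      facet, so it has an order there.\<close>
    have "c \<notin> face_kernel F" using c(2) F(1) minimal_prime_iff by blast
    then have g: "g \<noteq> 0" using c(1) by (simp add: face_kernel_def g_def)
    from ev obtain N where N: "\<And>e. e \<ge> N \<Longrightarrow> c \<otimes> x [^] (p ^ e) \<in> frobenius_power R A (p ^ e)"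
      by (auto simp: eventually_sequentially)
    \<comment> \<open>The exponent must reach the range where the tight closure condition holds and
      also make \<open>q\<close> exceed \<open>ord g\<close>; the latter follows from p^a >
      a.\<close>
    define q where "q = p ^ (max N (ord g))"
    have "c \<otimes> x [^] q \<in> D (q * k)"
      using N[of "max N (ord g)"] frobenius_power_D[OF A] by (auto simp: q_def)
    then have "low (q * k) (rs F (c \<otimes> x [^] q))" by (simp add: D_def rs_def low_filt)
    also have "rs F (c \<otimes> x [^] q) = g * f ^ q"
      using x c F\<Delta> by (simp add: rs_mult rs_pow f_def g_def)
    finally have "q * k \<le> ord (g * f ^ q)" using low_iff_ord[of "g * f ^ q"] f g by simp
    also have "\<dots> = ord g + q * ord f" using f g by (simp add: ord_mult ord_power)
    also have "\<dots> < q + q * ord f"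
    proof -
      have "ord g < p ^ ord g" using p by (simp add: power_gt_expt)
      also have "\<dots> \<le> q" unfolding q_def using p by (intro power_increasing) auto
      finally show ?thesis by simp
    qed
    also have "\<dots> = q * Suc (ord f)" by simp
    also have "\<dots> \<le> q * k" using ord_f by (intro mult_left_mono) auto
    finally show False by simp
  qed
qed

text \<open>
  On the component of a facet \<open>F\<close>, \<open>c\<close> is the monomial \<open>x\<^sub>F\<close>, and \<open>x\<^sub>F\<close> annihilates everything that
  vanishes on \<open>F\<close>. So \<open>c x\<^sup>q\<close> may be computed facet by facet, where \<open>x\<close> agrees with some element of \<open>A\<close>.
\<close>

lemma tight_closure_superset:
  assumes A: "facewise_full k A"
  shows "D k \<subseteq> tight_closure R p A"
proof
  fix x assume x: "x \<in> D k"
  have xR: "x \<in> carrier R" using x by (simp add: D_def)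
  have AR: "A \<subseteq> carrier R" using A D_carrier by (auto simp: facewise_full_def)
  define mon where "mon F = (Poly_Mapping.single (face_monomial F) 1 :: 'k mpoly)" for F
  have mon: "mon F \<in> carrier S" if "F \<in> facets" for F
    using that finite_face facet_face by (simp add: mon_def mon_closed)
  \<comment> \<open>The multiplier is \<open>C facets\<close>; partial sums over sets of facets
    allow an induction that treats one facet at a time.\<close>
  define C where "C \<Phi> = \<pi> (\<Sum>F\<in>\<Phi>. mon F)" for \<Phi>
  have sum_closed: "(\<Sum>F\<in>\<Phi>. mon F) \<in> carrier S" if "finite \<Phi>" "\<Phi> \<subseteq> facets" for \<Phi>
    using that by (induction \<Phi> rule: finite_induct) (auto simp: polynomial_ring_closed mon)
  have C: "C \<Phi> \<in> carrier R" if "finite \<Phi>" "\<Phi> \<subseteq> facets" for \<Phi>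
    using sum_closed[OF that] by (simp add: C_def sr_class_closed)
  have rs_C: "rs G (C \<Phi>) = (mon G when G \<in> \<Phi>)" if G: "G \<in> facets" and \<Phi>: "finite \<Phi>" "\<Phi> \<subseteq> facets" for G \<Phi>
  proof -
    have "rs G (C \<Phi>) = (\<Sum>F\<in>\<Phi>. restr G (mon F))"
      using sum_closed[OF \<Phi>] facet_face[OF G] by (simp add: C_def rs_sr_class filt_sum)
    also have "\<dots> = (\<Sum>F\<in>\<Phi>. if F = G then mon G else 0)"
    proof (rule sum.cong)
      fix F assume "F \<in> \<Phi>"
      then have F: "F \<in> facets" "finite F" using \<Phi> finite_face facet_face by blast+
      \<comment> \<open>Facets are incomparable, so the monomial of one facet restricts to 0 on
        every other.\<close>
      then have "F \<subseteq> G \<longleftrightarrow> F = G" using G by (auto simp: facets_def)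
      then show "restr G (mon F) = (if F = G then mon G else 0)"
        using F by (auto simp: mon_def filt_single)
    qed simp
    also have "\<dots> = (mon G when G \<in> \<Phi>)" using \<Phi> by (simp add: when_def)
    finally show ?thesis .
  qed
  have fin: "finite facets" using finite_complex by (simp add: facets_def)
  have mon_nz: "mon F \<noteq> 0" for F
    unfolding mon_def by (metis lookup_single_eq lookup_zero one_neq_zero)
  have "C facets \<notin> P" if "minimal_prime P R" for P
    using that rs_C[OF _ fin subset_refl] mon_nz by (auto simp: minimal_prime_iff face_kernel_def)
  moreover have "C facets \<otimes> x [^] q \<in> frobenius_power R A q" for q :: nat
  proof -
    have gen: "(\<lambda>y. y [^] q) ` A \<subseteq> carrier R" using AR by auto
    interpret Fr: ideal "frobenius_power R A q" R
      unfolding frobenius_power_def by (rule R.genideal_ideal[OF gen])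
    have "C \<Phi> \<otimes> x [^] q \<in> frobenius_power R A q" if "finite \<Phi>" "\<Phi> \<subseteq> facets" for \<Phi>
      using that
    proof (induction \<Phi> rule: finite_induct)
      case empty
      show ?case using xR Fr.zero_closed by (simp add: C_def sr_class_zero)
    next
      case (insert F \<Phi>)
      then have F: "F \<in> facets" "F \<in> \<Delta>" and \<Phi>: "\<Phi> \<subseteq> facets" using facet_face by auto
      obtain y where y: "y \<in> A" "rs F y = rs F x"
        using A F x unfolding facewise_full_def by blast
      have yR: "y \<in> carrier R" using y AR by blast
      have CF: "C {F} \<in> carrier R" using C[of "{F}"] F by simp
      have eq: "C {F} \<otimes> x [^] q = C {F} \<otimes> y [^] q"
      proof (rule eq_by_facets)
        fix G assume G: "G \<in> facets"
        note G\<Delta> = facet_face[OF G]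
        show "rs G (C {F} \<otimes> x [^] q) = rs G (C {F} \<otimes> y [^] q)"
          using y(2) F rs_C[OF G, of "{F}"] xR yR CF G\<Delta>
          by (cases "G = F") (simp_all add: rs_mult rs_pow)
      qed (use xR yR CF in auto)
      have "C (insert F \<Phi>) = C {F} \<oplus> C \<Phi>"
        using insert \<Phi> F by (simp add: C_def sum_closed mon flip: sr_class_add)
      then have "C (insert F \<Phi>) \<otimes> x [^] q = C {F} \<otimes> y [^] q \<oplus> C \<Phi> \<otimes> x [^] q"
        using CF C[OF insert(1) \<Phi>] xR eq by (simp add: R.l_distr)
      moreover have "y [^] q \<in> frobenius_power R A q"
        unfolding frobenius_power_def using R.genideal_self[OF gen] y by blast
      ultimately show ?case
        using insert \<Phi> CF by (auto intro!: Fr.a_closed Fr.I_l_closed)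
    qed
    then show ?thesis using fin by blast
  qed
  ultimately show "x \<in> tight_closure R p A"
    using xR C[OF fin subset_refl] unfolding tight_closure_def
    by (auto intro!: bexI[of _ "C facets"])
qed

theorem tight_closure_facewise_full:
  assumes "p \<ge> 2" "facewise_full k A"
  shows "tight_closure R p A = D k"
  using assms tight_closure_subset tight_closure_superset
  by (intro antisym) (auto simp: facewise_full_def)

end

subsection \<open>Dimensions and lengths\<close>

definition face_monomials :: "nat set set \<Rightarrow> nat \<Rightarrow> (nat \<Rightarrow>\<^sub>0 nat) set" where
  "face_monomials \<Delta> j = {m. supp m \<in> \<Delta> \<and> mdeg m = j}"

lemma const_poly_simps:
  "const_poly a * const_poly b = (const_poly (a * b) :: 'k::field mpoly)"
  "const_poly a + const_poly b = (const_poly (a + b) :: 'k mpoly)"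
  "- const_poly a = (const_poly (- a) :: 'k mpoly)"
  "const_poly 1 = (1 :: 'k mpoly)" "const_poly 0 = (0 :: 'k mpoly)"
  by (simp_all add: const_poly_def mult_single single_add single_uminus)

lemma const_poly_eq_0_iff [simp]: "const_poly a = 0 \<longleftrightarrow> a = (0 :: 'k::field)"
  by (metis const_poly_def const_poly_simps(5) lookup_single_eq lookup_zero)

context stanley_reisner
begin

lemma finite_face_monomials_less: "finite {m. face m \<and> mdeg m < k}"
  by (rule finite_subset[OF _ finite_monomials[of "{1..v}" k]]) (use face_subset in auto)

lemma finite_face_monomials: "finite (face_monomials \<Delta> j)"
  by (rule finite_subset[OF _ finite_face_monomials_less[of "Suc j"]]) (auto simp: face_monomials_def)

lemma const_poly_closed: "const_poly c \<in> carrier S"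
  by (simp add: const_poly_def mon_closed empty_face)

lemma nf_const_mult: "a \<in> carrier R \<Longrightarrow> nf (\<pi> (const_poly c) \<otimes> a) = const_poly c * nf a"
proof -
  assume a: "a \<in> carrier R"
  have "nf (\<pi> (const_poly c)) = const_poly c"
    by (simp add: nf_sr_class const_poly_closed) (simp add: const_poly_def filt_single empty_face)
  then show ?thesis
    using a by (simp add: nf_mult sr_class_closed const_poly_closed filt_const_mult nf_face(2))
qed

lemma subfield_scalars: "subfield (sr_scalars v \<Delta>) R"
proof -
  let ?K = "range const_poly :: 'k mpoly set"
  have "subring ?K S"
    by (rule S.subringI)
      (auto simp: const_poly_closed const_poly_simps simp flip: const_poly_simps(4))
  then have sub: "subcring ?K S" by (rule S.subcringI')
  have "subfield ?K S"
  proof (rule S.subfieldI[OF sub])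
    show "Units (S\<lparr>carrier := ?K\<rparr>) = ?K - {\<zero>\<^bsub>S\<^esub>}"
    proof (intro equalityI subsetI)
      fix f assume f: "f \<in> Units (S\<lparr>carrier := ?K\<rparr>)"
      then have "f \<in> ?K" by (simp add: Units_def)
      moreover have "f \<noteq> 0" using f by (auto simp: Units_def)
      ultimately show "f \<in> ?K - {\<zero>\<^bsub>S\<^esub>}" by simp
    next
      fix f assume "f \<in> ?K - {\<zero>\<^bsub>S\<^esub>}"
      then obtain c where "f = const_poly c" "c \<noteq> 0" by (auto simp: const_poly_simps)
      then show "f \<in> Units (S\<lparr>carrier := ?K\<rparr>)"
        by (auto simp: Units_def const_poly_simps intro!: exI[of _ "inverse c"])
    qed
  qed
  then have "subfield (\<pi> ` ?K) R"
    by (rule \<pi>.img_is_subfield(2)[OF _ one_not_zero])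
  then show ?thesis by (simp add: sr_scalars_def image_image)
qed

text \<open>Splitting off the coefficient of one monomial exhibits the larger span as a line
  extension of the smaller, matching the inductive construction of \<open>dimension\<close>.\<close>

lemma dimension_monomial_span:
  assumes "finite U" "\<And>m. m \<in> U \<Longrightarrow> face m"
  shows "R.dimension (card U) (sr_scalars v \<Delta>) {a \<in> carrier R. supp (nf a) \<subseteq> U}"
  using assms
proof (induction U rule: finite_induct)
  case empty
  have "{a \<in> carrier R. supp (nf a) \<subseteq> {}} = {\<zero>}"
    by (auto simp: supp_empty_iff nf_eq_0_iff)
  then show ?case by simp
next
  case (insert m U)
  let ?E = "\<lambda>U. {a \<in> carrier R. supp (nf a) \<subseteq> U}" and ?K = "sr_scalars v \<Delta> :: 'k mpoly set set"
  let ?x = "\<pi> (Poly_Mapping.single m 1)"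
  have m: "face m" using insert.prems by simp
  have x: "?x \<in> carrier R" "nf ?x = Poly_Mapping.single m 1"
    using m by (simp_all add: sr_class_closed mon_closed nf_sr_class filt_single)
  have cx: "const_poly c * Poly_Mapping.single m 1 = Poly_Mapping.single m c" for c :: 'k
    by (simp add: const_poly_def mult_single)
  have "R.line_extension ?K ?x (?E U) = ?E (insert m U)"
  proof (intro equalityI subsetI)
    fix u assume "u \<in> R.line_extension ?K ?x (?E U)"
    then obtain c w where u: "u = \<pi> (const_poly c) \<otimes> ?x \<oplus> w" and w: "w \<in> carrier R" "supp (nf w) \<subseteq> U"
      by (auto simp: R.line_extension_mem_iff sr_scalars_def)
    have "u \<in> carrier R" using u w x by (simp add: sr_class_closed const_poly_closed)
    moreover have "nf u = Poly_Mapping.single m c + nf w"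
      using x w by (simp add: u nf_add nf_const_mult sr_class_closed const_poly_closed cx)
    ultimately show "u \<in> ?E (insert m U)"
      using w(2) by (auto simp: in_keys_iff lookup_add lookup_single when_def split: if_splits)
  next
    fix u assume "u \<in> ?E (insert m U)"
    then have u: "u \<in> carrier R" "supp (nf u) \<subseteq> insert m U" by simp_all
    define c where "c = coef (nf u) m"
    define f where "f = Poly_Mapping.update m 0 (nf u)"
    have f: "supp f \<subseteq> U" using u(2) by (auto simp: f_def keys_update)
    have ff: "face y" if "y \<in> supp f" for y using that f insert.prems by auto
    have nf_f: "nf (\<pi> f) = f" "\<pi> f \<in> carrier R"
      using ff faces_in_carrier by (simp_all add: nf_sr_class filt_id sr_class_closed)
    have "nf u = Poly_Mapping.single m c + f"
      by (rule poly_mapping_eqI) (auto simp: f_def c_def lookup_add lookup_single lookup_update when_def)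
    also have "\<dots> = nf (\<pi> (const_poly c) \<otimes> ?x \<oplus> \<pi> f)"
      using x nf_f by (simp add: nf_add nf_const_mult sr_class_closed const_poly_closed cx)
    finally have u_eq: "u = \<pi> (const_poly c) \<otimes> ?x \<oplus> \<pi> f"
      using nf_inject u(1) x nf_f by (simp add: sr_class_closed const_poly_closed)
    show "u \<in> R.line_extension ?K ?x (?E U)"
      unfolding R.line_extension_mem_iff sr_scalars_def
    proof (rule bexI, rule bexI)
      show "u = \<pi> (const_poly c) \<otimes> ?x \<oplus> \<pi> f" by (rule u_eq)
      show "\<pi> f \<in> ?E U" using nf_f f by simp
    qed (rule rangeI)
  qed
  moreover have "?x \<notin> ?E U" using x insert.hyps by simp
  moreover have "R.dimension (card U) ?K (?E U)" using insert by simp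
  ultimately show ?case
    using R.Suc_dim[of ?x "?E U" "card U" ?K] x insert.hyps by simp
qed

lemma dim_sr_component:
  "ring.dim R (sr_scalars v \<Delta>) (sr_component v \<Delta> j) = card (face_monomials \<Delta> j)"
proof -
  have "sr_component v \<Delta> j = {a \<in> carrier R. supp (nf a) \<subseteq> face_monomials \<Delta> j}"
    by (auto simp: sr_component_eq face_monomials_def dest: nf_face(1))
  then have "R.dimension (card (face_monomials \<Delta> j)) (sr_scalars v \<Delta>) (sr_component v \<Delta> j)"
    using dimension_monomial_span[OF finite_face_monomials[of j]] by (simp add: face_monomials_def)
  then show ?thesis using R.dimI[OF subfield_scalars] by (simp add: over_def)
qed

text \<open>
  Modulo \<^term>\<open>D k\<close> an ideal is determined by its finite set of leading monomials, and a strict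
  inclusion of ideals gives a strict inclusion of these sets.
\<close>

definition trunc :: "nat \<Rightarrow> 'k mpoly set \<Rightarrow> 'k mpoly" where
  "trunc k a = filt (\<lambda>m. mdeg m < k) (nf a)"

definition leading :: "nat \<Rightarrow> 'k mpoly set set \<Rightarrow> (nat \<Rightarrow>\<^sub>0 nat) set" where
  "leading k L = {Max (supp (trunc k a)) | a. a \<in> L \<and> trunc k a \<noteq> 0}"

lemma trunc_eq_0_iff: "a \<in> carrier R \<Longrightarrow> trunc k a = 0 \<longleftrightarrow> a \<in> D k"
  by (auto simp: trunc_def filt_eq_0_iff D_def low_def not_less)

lemma supp_trunc: "a \<in> carrier R \<Longrightarrow> supp (trunc k a) \<subseteq> {m. face m \<and> mdeg m < k}"
  by (auto simp: trunc_def supp_filt dest: nf_face(1))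

lemma leading_subset:
  assumes "L \<subseteq> carrier R"
  shows "leading k L \<subseteq> {m. face m \<and> mdeg m < k}"
proof
  fix m assume "m \<in> leading k L"
  then obtain a where a: "a \<in> L" "trunc k a \<noteq> 0" "m = Max (supp (trunc k a))"
    by (auto simp: leading_def)
  then have "m \<in> supp (trunc k a)" by (simp add: supp_empty_iff)
  then show "m \<in> {m. face m \<and> mdeg m < k}" using supp_trunc a assms by blast
qed

text \<open>Gaussian elimination: an element of \<open>L'\<close> is reduced by scalar multiples of
  elements of \<open>L\<close> with the same leading monomial until it falls into
  \<open>D k\<close>. Only scalar multiples are used, so the linear order on monomials enters merely
  as a way to pick a maximum.\<close>

lemma leading_eq_imp_subset:
  assumes L: "ideal L R" "D k \<subseteq> L" and L': "ideal L' R" "L \<subseteq> L'"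
    and eq: "leading k L = leading k L'"
  shows "L' \<subseteq> L"
proof
  interpret L: ideal L R by (rule L(1))
  interpret L': ideal L' R by (rule L'(1))
  let ?M = "{m. face m \<and> mdeg m < k}"
  fix a assume "a \<in> L'"
  then show "a \<in> L"
  \<comment> \<open>The measure counts the face monomials of degree below \<open>k\<close> up to the
    leading one, so termination rests on finiteness.\<close>
  proof (induction "card {x \<in> ?M. x \<le> Max (supp (trunc k a))}" arbitrary: a rule: less_induct)
    case less
    have aR: "a \<in> carrier R" using less.prems by (rule L'.Icarr)
    show ?case
    proof (cases "trunc k a = 0")
      case True
      then show ?thesis using L(2) aR trunc_eq_0_iff by auto
    next
      case False
      define m where "m = Max (supp (trunc k a))"
      have m: "m \<in> supp (trunc k a)" using False by (simp add: m_def supp_empty_iff)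
      have "m \<in> leading k L" unfolding eq using False less.prems by (auto simp: leading_def m_def)
      then obtain b where b: "b \<in> L" "trunc k b \<noteq> 0" "m = Max (supp (trunc k b))"
        by (auto simp: leading_def)
      have bR: "b \<in> carrier R" using b(1) by (rule L.Icarr)
      \<comment> \<open>Chosen to cancel the coefficient at the common leading monomial
        \<open>m\<close>.\<close>
      define c where "c = - coef (trunc k a) m / coef (trunc k b) m"
      define b' where "b' = \<pi> (const_poly c) \<otimes> b"
      have mb: "m \<in> supp (trunc k b)" using b(2) by (simp add: b(3) supp_empty_iff)
      have b': "b' \<in> L" unfolding b'_def
        using b(1) by (intro L.I_l_closed sr_class_closed const_poly_closed)
      then have b'R: "b' \<in> carrier R" by (rule L.Icarr)
      have tr: "trunc k (a \<oplus> b') = trunc k a + const_poly c * trunc k b"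
        using aR bR b'R by (simp add: trunc_def nf_add filt_add b'_def nf_const_mult filt_const_mult)
      have lt: "x < m" if x: "x \<in> supp (trunc k (a \<oplus> b'))" for x
      proof -
        have "x \<in> supp (trunc k a) \<union> supp (trunc k b)"
          using x keys_add[of "trunc k a" "const_poly c * trunc k b"] supp_const_mult[of c "trunc k b"]
          unfolding tr by blast
        then have "x \<le> m" using b(3) m_def Max_ge[OF finite_keys] by (metis UnE)
        moreover have "x \<noteq> m"
          using x mb by (auto simp: tr in_keys_iff lookup_add lookup_const_mult c_def)
        ultimately show ?thesis by simp
      qed
      have ab': "a \<oplus> b' \<in> L'" "a \<oplus> b' \<in> carrier R"
        using less.prems b' L'(2) aR b'R by (auto intro: L'.a_closed)
      have "a \<oplus> b' \<in> L"
      proof (cases "trunc k (a \<oplus> b') = 0")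
        case True
        then show ?thesis using L(2) ab' trunc_eq_0_iff by auto
      next
        case nz: False
        let ?m = "Max (supp (trunc k (a \<oplus> b')))"
        have "?m < m" using nz lt by (simp add: supp_empty_iff)
        then have "{x \<in> ?M. x \<le> ?m} \<subset> {x \<in> ?M. x \<le> m}"
          using m supp_trunc[OF aR] by force
        then have "card {x \<in> ?M. x \<le> ?m} < card {x \<in> ?M. x \<le> m}"
          by (rule psubset_card_mono[rotated]) (rule finite_subset[OF _ finite_face_monomials_less[of k]], auto)
        then show ?thesis using less.hyps ab' unfolding m_def by blast
      qed
      from L.a_closed[OF this L.a_inv_closed[OF b']]
      have "(a \<oplus> b') \<oplus> (\<ominus> b') \<in> L" .
      moreover have "(a \<oplus> b') \<oplus> (\<ominus> b') = a" using aR b'R by (simp add: R.a_assoc R.r_neg)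
      ultimately show ?thesis by (simp only:)
    qed
  qed
qed

lemma ideal_chain_length_le:
  assumes L: "\<And>i. i \<le> n \<Longrightarrow> ideal (L i) R" "\<And>i. i \<le> n \<Longrightarrow> D k \<subseteq> L i"
    "\<And>i. i < n \<Longrightarrow> L i \<subset> L (Suc i)"
  shows "n \<le> card {m. face m \<and> mdeg m < k}"
proof -
  have sub: "leading k (L i) \<subseteq> {m. face m \<and> mdeg m < k}" if "i \<le> n" for i
    by (rule leading_subset[OF additive_subgroup.a_subset[OF ideal.axioms(1)[OF L(1)[OF that]]]])
  have "i \<le> card (leading k (L i))" if "i \<le> n" for i
    using that
  proof (induction i)
    case (Suc i)
    have "leading k (L i) \<subseteq> leading k (L (Suc i))"
      using L(3)[of i] Suc.prems by (auto simp: leading_def)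
    moreover have "leading k (L i) \<noteq> leading k (L (Suc i))"
      using leading_eq_imp_subset[of "L i" k "L (Suc i)"] L(1)[of i] L(2)[of i] L(1)[of "Suc i"] L(3)[of i] Suc.prems
      by auto
    ultimately have "card (leading k (L i)) < card (leading k (L (Suc i)))"
      using sub[OF Suc.prems] finite_face_monomials_less
      by (intro psubset_card_mono) (auto intro: finite_subset)
    then show ?case using Suc by simp
  qed simp
  then have "n \<le> card (leading k (L n))" by simp
  also have "\<dots> \<le> card {m. face m \<and> mdeg m < k}"
    using sub[of n] finite_face_monomials_less by (intro card_mono) auto
  finally show ?thesis .
qed

text \<open>The upper bound is \<open>ideal_chain_length_le\<close>. A chain attaining it adjoins
  the face monomials one at a time from the highest degree downwards, so that every stage is closed
  under multiplication.\<close>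

lemma quotient_length_D: "quotient_length R (D k) = enat (card {m. face m \<and> mdeg m < k})"
proof -
  let ?M = "{m. face m \<and> mdeg m < k}"
  obtain xs where xs: "set xs = ?M" "distinct xs"
    using finite_distinct_list[OF finite_face_monomials_less] by blast
  \<comment> \<open>All degrees are below \<open>k\<close>, so increasing \<open>k - mdeg m\<close>
    means decreasing degree.\<close>
  define ms where "ms = sort_key (\<lambda>m. k - mdeg m) xs"
  have ms: "set ms = ?M" "distinct ms" "sorted (map (\<lambda>m. k - mdeg m) ms)"
    using xs by (simp_all add: ms_def)
  have len: "length ms = card ?M" using ms distinct_card by metis
  have up: "m \<in> set (take i ms)" if m: "m \<in> ?M" "m' \<in> set (take i ms)" "mdeg m' < mdeg m" for m m' i
  proof -
    obtain j where j: "j < length ms" "j < i" "m' = ms ! j"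
      using m(2) by (auto simp: in_set_conv_nth)
    obtain l where l: "l < length ms" "m = ms ! l"
      using m(1) ms(1) by (metis in_set_conv_nth)
    have "l < i"
    proof (rule ccontr)
      assume "\<not> l < i"
      then have "k - mdeg (ms ! j) \<le> k - mdeg (ms ! l)"
        using sorted_nth_mono[OF ms(3), of j l] j l by simp
      then show False using m j l by auto
    qed
    then show ?thesis using l by (auto simp: in_set_conv_nth)
  qed
  define L where "L i = {a \<in> carrier R. \<forall>m\<in>supp (nf a). mdeg m < k \<longrightarrow> m \<in> set (take i ms)}" for i
  show ?thesis
  proof (rule R.quotient_length_eqI[where L = L, OF ideal_D])
    show "n \<le> card ?M" if "\<And>i. i \<le> n \<Longrightarrow> ideal (L' i) R" "\<And>i. i \<le> n \<Longrightarrow> D k \<subseteq> L' i"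
      "\<And>i. i < n \<Longrightarrow> L' i \<subset> L' (Suc i)" for L' n
      using that by (rule ideal_chain_length_le)
    show "ideal (L i) R" for i
    proof (rule ideal_R_I)
      show "a \<oplus> b \<in> L i" if "a \<in> L i" "b \<in> L i" for a b
        using that keys_add[of "nf a" "nf b"] by (auto simp: L_def nf_add)
      show "x \<otimes> a \<in> L i" if a: "a \<in> L i" and x: "x \<in> carrier R" for a x
      proof -
        have aR: "a \<in> carrier R" using a by (simp add: L_def)
        have "m \<in> set (take i ms)" if m: "m \<in> supp (nf (x \<otimes> a))" "mdeg m < k" for m
        proof -
          have "m \<in> supp (nf x * nf a)" "face m" using m x aR by (auto simp: nf_mult supp_filt)
          then obtain m1 m2 where m12: "m2 \<in> supp (nf a)" "m = m1 + m2"
            by (metis supp_mult_cases)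
          then have m2: "m2 \<in> set (take i ms)" using a m(2) by (auto simp: L_def)
          \<comment> \<open>A nontrivial factor \<open>m1\<close> raises the degree, and by
            \<open>up\<close> every face monomial of higher degree below \<open>k\<close> has been
            adjoined earlier.\<close>
          show ?thesis
          proof (cases "m1 = 0")
            case True
            then show ?thesis using m12 m2 by simp
          next
            case False
            then have "mdeg m1 \<noteq> 0" by simp
            then have "mdeg m2 < mdeg m1 + mdeg m2" by linarith
            then have "mdeg m2 < mdeg m" using m12 by simp
            then show ?thesis using up[of m m2 i] m2 m(2) \<open>face m\<close> by simp
          qed
        qed
        then show ?thesis using x aR by (simp add: L_def)
      qed
    qed (auto simp: L_def)
    show "D k \<subseteq> L i" for i by (auto simp: L_def D_def low_def)
    show "L i \<subset> L (Suc i)" if i: "i < card ?M" for i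
    proof
      have il: "i < length ms" using i len by simp
      show "L i \<subseteq> L (Suc i)" using il by (auto simp: L_def take_Suc_conv_app_nth)
      let ?m = "ms ! i"
      have m: "face ?m" "mdeg ?m < k" using nth_mem[OF il] ms(1) by auto
      have notin: "?m \<notin> set (take i ms)"
        using il ms(2) by (auto simp: in_set_conv_nth nth_eq_iff_index_eq)
      let ?x = "\<pi> (Poly_Mapping.single ?m 1)"
      have x: "?x \<in> carrier R" "nf ?x = Poly_Mapping.single ?m 1"
        using m by (simp_all add: sr_class_closed mon_closed nf_sr_class filt_single)
      have "?x \<in> L (Suc i)" using x il by (simp add: L_def take_Suc_conv_app_nth)
      moreover have "?x \<notin> L i" using x m notin by (simp add: L_def)
      ultimately show "L i \<noteq> L (Suc i)" by blast
    qed
  qed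
qed

lemma card_face_monomials_less:
  "card {m. face m \<and> mdeg m < k} = (\<Sum>j<k. card (face_monomials \<Delta> j))"
proof -
  have "{m. face m \<and> mdeg m < k} = (\<Union>j\<in>{..<k}. face_monomials \<Delta> j)"
    by (auto simp: face_monomials_def)
  then show ?thesis
    using card_UN_disjoint[of "{..<k}" "face_monomials \<Delta>"] finite_face_monomials
    by (simp add: face_monomials_def disjoint_iff)
qed

end

subsection \<open>The Hilbert series of a Stanley-Reisner ring\<close>

lemma finite_monomials_exact:
  assumes "finite F"
  shows "finite {m. supp m = F \<and> mdeg m = j}"
  by (rule finite_subset[OF _ finite_monomials[OF assms, of j]]) auto

text \<open>After division by the variable of \<open>i\<close> its exponent is either still positive
  or zero, and these are the two sets on the right.\<close>

lemma monomials_insert_Suc: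
  assumes "i \<notin> F"
  shows "{m. supp m = insert i F \<and> mdeg m = Suc j} =
    (\<lambda>m. Poly_Mapping.single i 1 + m) `
      ({m. supp m = insert i F \<and> mdeg m = j} \<union> {m. supp m = F \<and> mdeg m = j})"
proof (intro equalityI subsetI)
  fix m assume m: "m \<in> {m. supp m = insert i F \<and> mdeg m = Suc j}"
  then obtain n where n: "m = Poly_Mapping.single i 1 + n"
    using monomial_split_var[of i m] by auto
  have "insert i (supp n) = insert i F" using m unfolding n by (auto simp: supp_add_nat)
  then have "supp n = insert i F \<or> supp n = F" using assms by (cases "i \<in> supp n") auto
  moreover have "mdeg n = j" using m unfolding n by simp
  ultimately show "m \<in> (\<lambda>m. Poly_Mapping.single i 1 + m) `
      ({m. supp m = insert i F \<and> mdeg m = j} \<union> {m. supp m = F \<and> mdeg m = j})"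
    unfolding n by blast
next
  fix m assume "m \<in> (\<lambda>m. Poly_Mapping.single i 1 + m) `
      ({m. supp m = insert i F \<and> mdeg m = j} \<union> {m. supp m = F \<and> mdeg m = j})"
  then obtain n where n: "m = Poly_Mapping.single i 1 + n" "supp n = insert i F \<or> supp n = F" "mdeg n = j"
    by blast
  then have "supp m = insert i F" unfolding n(1) supp_add_nat by auto
  then show "m \<in> {m. supp m = insert i F \<and> mdeg m = Suc j}" using n by simp
qed

text \<open>Each variable of \<open>F\<close> must occur and contributes \<lambda>/(1 - \<lambda>).
  Adding a vertex multiplies the series by this factor, which is the recursion of
  \<open>monomials_insert_Suc\<close> in terms of series.\<close>

lemma hilbert_series_face:
  assumes "finite F"
  shows "Abs_fps (\<lambda>j. real (card {m. supp m = F \<and> mdeg m = j})) * (1 - fps_X) ^ card F = fps_X ^ card F"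
  using assms
proof (induction F rule: finite_induct)
  case empty
  have "{m :: nat \<Rightarrow>\<^sub>0 nat. m = 0 \<and> mdeg m = j} = (if j = 0 then {0} else {})" for j by auto
  then have "Abs_fps (\<lambda>j. real (card {m :: nat \<Rightarrow>\<^sub>0 nat. supp m = {} \<and> mdeg m = j})) = 1"
    by (intro fps_ext) (simp add: supp_empty_iff)
  then show ?case by simp
next
  case (insert i F)
  let ?N = "\<lambda>F j. card {m. supp m = F \<and> mdeg m = j}"
  let ?G = "\<lambda>F. Abs_fps (\<lambda>j. real (?N F j))"
  have rec: "?N (insert i F) (Suc j) = ?N (insert i F) j + ?N F j" for j
  proof -
    have "?N (insert i F) (Suc j) = card ({m. supp m = insert i F \<and> mdeg m = j} \<union> {m. supp m = F \<and> mdeg m = j})"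
      unfolding monomials_insert_Suc[OF insert.hyps(2)] by (rule card_image) simp
    also have "\<dots> = ?N (insert i F) j + ?N F j"
      using insert.hyps by (intro card_Un_disjoint finite_monomials_exact) auto
    finally show ?thesis .
  qed
  have "{m :: nat \<Rightarrow>\<^sub>0 nat. supp m = insert i F \<and> mdeg m = 0} = {}" by auto
  then have zero: "?N (insert i F) 0 = 0" by (simp only: card.empty)
  have "?G (insert i F) * (1 - fps_X) = fps_X * ?G F"
  proof (rule fps_ext)
    fix n
    show "fps_nth (?G (insert i F) * (1 - fps_X)) n = fps_nth (fps_X * ?G F) n"
      using zero by (cases n) (simp_all add: rec right_diff_distrib del: mdeg_eq_0_iff)
  qed
  then have "?G (insert i F) * (1 - fps_X) ^ Suc (card F) = fps_X * (?G F * (1 - fps_X) ^ card F)"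
    by (simp add: mult.assoc[symmetric])
  then show ?case using insert by simp
qed

text \<open>The passage from the f-vector to the h-vector: a face contributes (\<lambda>/(1 -
  \<lambda>))^|F| to the Hilbert series, here multiplied by (1 - \<lambda>)^d.\<close>

definition face_polynomial :: "nat \<Rightarrow> nat set set \<Rightarrow> real poly" where
  "face_polynomial d \<Delta> = (\<Sum>F\<in>\<Delta>. [:0, 1:] ^ card F * [:1, -1:] ^ (d - card F))"


lemma degree_face_polynomial:
  assumes "finite \<Delta>" "\<And>F. F \<in> \<Delta> \<Longrightarrow> card F \<le> d"
  shows "Polynomial.degree (face_polynomial d \<Delta>) \<le> d"
  unfolding face_polynomial_def
proof (rule degree_sum_le[OF assms(1)])
  fix F assume F: "F \<in> \<Delta>"
  have "Polynomial.degree ([:0, 1 :: real:] ^ card F * [:1, -1:] ^ (d - card F))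
      \<le> Polynomial.degree ([:0, 1 :: real:] ^ card F) + Polynomial.degree ([:1, -1 :: real:] ^ (d - card F))"
    by (rule degree_mult_le)
  also have "\<dots> \<le> card F + (d - card F)"
    using degree_power_le[of "[:0, 1 :: real:]" "card F"] degree_power_le[of "[:1, -1 :: real:]" "d - card F"]
    by (intro add_mono) simp_all
  finally show "Polynomial.degree ([:0, 1 :: real:] ^ card F * [:1, -1:] ^ (d - card F)) \<le> d"
    using assms(2)[OF F] by simp
qed

lemma fps_of_poly_one_minus_X: "fps_of_poly [:1, -1 :: real:] = 1 - fps_X"
  by (simp add: fps_of_poly_pCons fps_of_poly_linear')

lemma hilbert_series_complex:
  assumes "finite \<Delta>" "\<And>F. F \<in> \<Delta> \<Longrightarrow> finite F \<and> card F \<le> d"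
  shows "Abs_fps (\<lambda>j. real (card (face_monomials \<Delta> j))) * (1 - fps_X) ^ d = fps_of_poly (face_polynomial d \<Delta>)"
proof -
  have card: "card (face_monomials \<Delta> j) = (\<Sum>F\<in>\<Delta>. card {m. supp m = F \<and> mdeg m = j})" for j
  proof -
    have "face_monomials \<Delta> j = (\<Union>F\<in>\<Delta>. {m. supp m = F \<and> mdeg m = j})"
      by (auto simp: face_monomials_def)
    then show ?thesis
      using card_UN_disjoint[of \<Delta> "\<lambda>F. {m. supp m = F \<and> mdeg m = j}"] assms finite_monomials_exact
      by auto
  qed
  have "Abs_fps (\<lambda>j. real (card (face_monomials \<Delta> j)))
      = (\<Sum>F\<in>\<Delta>. Abs_fps (\<lambda>j. real (card {m. supp m = F \<and> mdeg m = j})))"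
    by (rule fps_ext) (simp add: card fps_sum_nth)
  then have "Abs_fps (\<lambda>j. real (card (face_monomials \<Delta> j))) * (1 - fps_X) ^ d
      = (\<Sum>F\<in>\<Delta>. Abs_fps (\<lambda>j. real (card {m. supp m = F \<and> mdeg m = j})) * (1 - fps_X) ^ d)"
    by (simp only: sum_distrib_right)
  also have "\<dots> = (\<Sum>F\<in>\<Delta>. fps_X ^ card F * (1 - fps_X) ^ (d - card F))"
  proof (rule sum.cong)
    fix F assume "F \<in> \<Delta>"
    then have F: "finite F" "card F \<le> d" using assms by auto
    then have "(1 - fps_X :: real fps) ^ d = (1 - fps_X) ^ card F * (1 - fps_X) ^ (d - card F)"
      by (simp flip: power_add)
    then show "Abs_fps (\<lambda>j. real (card {m. supp m = F \<and> mdeg m = j})) * (1 - fps_X) ^ d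
        = fps_X ^ card F * (1 - fps_X) ^ (d - card F)"
      using hilbert_series_face[OF F(1)] by (simp only: mult.assoc[symmetric])
  qed simp
  also have "\<dots> = fps_of_poly (face_polynomial d \<Delta>)"
    by (simp add: face_polynomial_def fps_of_poly_sum fps_of_poly_mult fps_of_poly_power
        fps_of_poly_one_minus_X del: fps_of_poly_pCons)
  finally show ?thesis .
qed

lemma one_minus_fps_X_power_nonzero: "(1 - fps_X :: real fps) ^ n \<noteq> 0"
proof -
  have "fps_nth (1 - fps_X :: real fps) 0 \<noteq> 0" by simp
  then have "(1 - fps_X :: real fps) \<noteq> 0" by (metis fps_zero_nth)
  then show ?thesis by simp
qed

lemma h_polynomial_eqI:
  assumes "hilbert_series R K gr * (1 - fps_X) ^ d = fps_of_poly h" "Polynomial.degree h \<le> d"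
  shows "h_polynomial R K gr d = h"
  unfolding h_polynomial_def
proof (rule the_equality)
  have iff: "hilbert_series R K gr = fps_of_poly h' / (1 - fps_X) ^ d \<longleftrightarrow>
      hilbert_series R K gr * (1 - fps_X) ^ d = fps_of_poly h'" for h'
  proof
    assume "hilbert_series R K gr = fps_of_poly h' / (1 - fps_X) ^ d"
    moreover have "fps_of_poly h' / (1 - fps_X) ^ d * (1 - fps_X) ^ d = fps_of_poly h'"
      by (simp add: fps_divide_unit mult.assoc inverse_mult_eq_1)
    ultimately show "hilbert_series R K gr * (1 - fps_X) ^ d = fps_of_poly h'" by simp
  next
    assume "hilbert_series R K gr * (1 - fps_X) ^ d = fps_of_poly h'"
    then show "hilbert_series R K gr = fps_of_poly h' / (1 - fps_X) ^ d"
      using one_minus_fps_X_power_nonzero by (metis nonzero_mult_div_cancel_right)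
  qed
  show "Polynomial.degree h \<le> d \<and> hilbert_series R K gr = fps_of_poly h / (1 - fps_X) ^ d"
    using assms iff by simp
  show "h' = h" if "Polynomial.degree h' \<le> d \<and> hilbert_series R K gr = fps_of_poly h' / (1 - fps_X) ^ d" for h'
    using that assms(1) iff[of h'] by (simp add: fps_of_poly_eq_iff)
qed


subsection \<open>Hilbert polynomials\<close>

definition taylor_coeff :: "real poly \<Rightarrow> nat \<Rightarrow> real" where
  "taylor_coeff h i = poly ((pderiv ^^ i) h) 1 / fact i"

lemma poly_higher_pderiv_0: "poly ((pderiv ^^ i) q) 0 = fact i * Polynomial.coeff q i"
  for q :: "real poly"
  by (simp add: poly_0_coeff_0 coeff_higher_pderiv pochhammer_fact)

text \<open>Shifting the argument by 1 reduces the expansion to reading off coefficients at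
  0.\<close>

lemma taylor_expansion_at_1:
  assumes "Polynomial.degree h \<le> d"
  shows "h = (\<Sum>i\<le>d. Polynomial.smult (taylor_coeff h i) ([:-1, 1:] ^ i))"
proof -
  define q where "q = pcompose h [:1, 1:]"
  have "(pderiv ^^ i) q = pcompose ((pderiv ^^ i) h) [:1, 1:]" for i
    by (induction i) (simp_all add: q_def pderiv_pcompose pderiv_pCons)
  then have coeff: "Polynomial.coeff q i = taylor_coeff h i" for i
    using poly_higher_pderiv_0[of i q] by (simp add: taylor_coeff_def poly_pcompose field_simps)
  have deg: "Polynomial.degree q \<le> d" using assms by (simp add: q_def degree_pcompose)
  show ?thesis
  proof (rule poly_ext)
    fix x
    have "poly h x = poly q (x - 1)" by (simp add: q_def poly_pcompose)
    also have "\<dots> = (\<Sum>i\<le>d. Polynomial.coeff q i * (x - 1) ^ i)"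
      unfolding poly_altdef using deg
      by (intro sum.mono_neutral_left) (auto simp: coeff_eq_0)
    also have "\<dots> = poly (\<Sum>i\<le>d. Polynomial.smult (taylor_coeff h i) ([:-1, 1:] ^ i)) x"
      by (simp add: poly_sum coeff poly_power add.commute)
    finally show "poly h x = poly (\<Sum>i\<le>d. Polynomial.smult (taylor_coeff h i) ([:-1, 1:] ^ i)) x" .
  qed
qed

text \<open>The d-th derivative is constant, so its values at 0 and at 1 agree. This is where h_d
  replaces the last derivative quotient.\<close>

lemma taylor_coeff_top:
  assumes "Polynomial.degree h \<le> d"
  shows "taylor_coeff h d = Polynomial.coeff h d"
proof -
  have "Polynomial.degree ((pderiv ^^ d) h) = 0" using assms by (simp add: degree_higher_pderiv)
  then obtain c where c: "(pderiv ^^ d) h = [:c:]" by (rule degree_eq_zeroE)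
  then show ?thesis using poly_higher_pderiv_0[of d h] by (simp add: taylor_coeff_def)
qed

lemma inverse_one_minus_fps_X_power:
  "inverse ((1 - fps_X :: real fps) ^ Suc k) = Abs_fps (\<lambda>n. real ((n + k) choose k))"
proof -
  have "inverse ((1 - fps_X :: real fps) ^ Suc k) = Abs_fps (\<lambda>n. real ((Suc k + n - 1) choose n) * 1 ^ n)"
    using one_minus_const_fps_X_neg_power'[of "Suc k" "1 :: real"] by simp
  also have "\<dots> = Abs_fps (\<lambda>n. real ((n + k) choose k))"
  proof (rule arg_cong[where f = Abs_fps], rule ext)
    fix n
    show "real ((Suc k + n - 1) choose n) * 1 ^ n = real ((n + k) choose k)"
      using binomial_symmetric[of n "n + k"] by (simp add: add.commute)
  qed
  finally show ?thesis .
qed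

text \<open>Partial sums divide the series by 1 - \<lambda>. Expanding \<open>h\<close> in powers of
  1 - \<lambda>, with signs from (\<lambda> - 1)^i, leaves multiples of 1/(1 - \<lambda>)^(d + 1 -
  i), whose coefficients are the binomials. Since \<open>h\<close> has degree at most
  \<open>d\<close>, these exponents are positive and the formula holds for every
  \<open>n\<close>.\<close>

lemma sum_hilbert_function:
  fixes c :: "nat \<Rightarrow> real"
  assumes "Abs_fps c * (1 - fps_X) ^ d = fps_of_poly h" "Polynomial.degree h \<le> d"
  shows "(\<Sum>j\<le>n. c j) = (\<Sum>i\<le>d. (-1) ^ i * taylor_coeff h i * real ((n + d - i) choose (d - i)))"
proof -
  let ?u = "1 - fps_X :: real fps"
  let ?H = "Abs_fps (\<lambda>n. \<Sum>j\<le>n. c j)"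
  let ?E = "\<Sum>i\<le>d. fps_const ((-1) ^ i * taylor_coeff h i) * inverse (?u ^ Suc (d - i))"
  have "?u * ?H = Abs_fps c"
    using fps_divide_fps_X_minus1_sum_lemma[of "Abs_fps c"] by (simp add: atLeast0AtMost)
  moreover have "?H * ?u ^ Suc d = (?u * ?H) * ?u ^ d" by (simp only: power_Suc mult_ac)
  ultimately have "?H * ?u ^ Suc d = fps_of_poly h"
    using assms(1) by (simp only:)
  moreover have "?E * ?u ^ Suc d = fps_of_poly h"
  proof -
    have inv: "inverse (?u ^ Suc (d - i)) * ?u ^ Suc d = ?u ^ i" if "i \<le> d" for i
    proof -
      have "?u ^ Suc d = ?u ^ Suc (d - i) * ?u ^ i"
        using that by (simp flip: power_add power_Suc)
      moreover have "inverse (?u ^ Suc (d - i)) * ?u ^ Suc (d - i) = 1"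
        by (rule inverse_mult_eq_1) simp
      ultimately show ?thesis by (simp only: mult.assoc[symmetric] mult_1)
    qed
    have "?E * ?u ^ Suc d = (\<Sum>i\<le>d. fps_const ((-1) ^ i * taylor_coeff h i) * ?u ^ i)"
      unfolding sum_distrib_right
      by (rule sum.cong) (simp_all only: mult.assoc inv atMost_iff)
    also have "\<dots> = (\<Sum>i\<le>d. fps_const (taylor_coeff h i) * (fps_of_poly [:-1, 1:]) ^ i)"
    proof (rule sum.cong)
      fix i
      have "fps_of_poly [:-1, 1 :: real:] = - ?u"
        by (simp add: fps_of_poly_linear)
      then have "fps_of_poly [:-1, 1 :: real:] ^ i = (-1) ^ i * ?u ^ i"
        by (simp only: power_minus[of ?u])
      also have "(-1 :: real fps) = fps_const (-1)"
        by (metis fps_const_1_eq_1 fps_const_neg)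
      finally have "fps_of_poly [:-1, 1 :: real:] ^ i = fps_const ((-1) ^ i) * ?u ^ i"
        by (simp only: fps_const_power)
      then show "fps_const ((-1) ^ i * taylor_coeff h i) * ?u ^ i
          = fps_const (taylor_coeff h i) * fps_of_poly [:-1, 1:] ^ i"
        by (simp only: fps_const_mult[symmetric] mult_ac)
    qed simp
    also have "\<dots> = fps_of_poly h"
      by (subst (2) taylor_expansion_at_1[OF assms(2)])
        (simp add: fps_of_poly_sum fps_of_poly_smult fps_of_poly_power)
    finally show ?thesis .
  qed
  ultimately have "?H * ?u ^ Suc d = ?E * ?u ^ Suc d" by (simp only:)
  then have "?H = ?E"
    by (rule mult_right_cancel[OF one_minus_fps_X_power_nonzero, THEN iffD1])
  then have "fps_nth ?H n = fps_nth ?E n" by simp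
  then show ?thesis
    by (simp add: fps_sum_nth inverse_one_minus_fps_X_power del: power_Suc)
qed

text \<open>The binomial coefficient (x + k - 1 choose k) as a polynomial in x. With k = d - i these
  are the functions in which Hilbert polynomials are expanded, and all but the one for k = 0 vanish
  at 0.\<close>

definition rising_poly :: "nat \<Rightarrow> real poly" where
  "rising_poly k = Polynomial.smult (1 / fact k) (pochhammer [:0, 1:] k)"

lemma poly_rising_poly: "poly (rising_poly k) x = pochhammer x k / fact k"
proof -
  have "poly (pochhammer [:0, 1:] k) x = pochhammer x k"
    by (induction k) (simp_all add: pochhammer_Suc)
  then show ?thesis by (simp add: rising_poly_def)
qed

lemma poly_rising_poly_nat:
  assumes "n \<ge> 1"
  shows "poly (rising_poly k) (real n) = real ((n + k - 1) choose k)"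
  using assms by (simp add: poly_rising_poly binomial_gbinomial gbinomial_pochhammer' of_nat_diff)

lemma rising_poly_0 [simp]: "rising_poly 0 = 1"
  by (simp add: rising_poly_def)

lemma coeff_pochhammer_X:
  "Polynomial.degree (pochhammer [:0, 1 :: real:] k) = k \<and> Polynomial.coeff (pochhammer [:0, 1 :: real:] k) k = 1"
proof (induction k)
  case (Suc k)
  have "[:0, 1:] + of_nat k = [:real k, 1:]"
    by (simp add: of_nat_poly)
  then have eq: "pochhammer [:0, 1 :: real:] (Suc k) = pochhammer [:0, 1:] k * [:real k, 1:]"
    by (simp add: pochhammer_Suc)
  have nz: "pochhammer [:0, 1 :: real:] k \<noteq> 0" using Suc by auto
  then have deg: "Polynomial.degree (pochhammer [:0, 1 :: real:] (Suc k)) = Suc k"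
    unfolding eq using Suc by (subst degree_mult_eq) auto
  moreover have "lead_coeff (pochhammer [:0, 1 :: real:] (Suc k)) = 1"
    unfolding eq lead_coeff_mult using Suc by simp
  ultimately show ?case by simp
qed simp

lemma degree_rising_poly: "Polynomial.degree (rising_poly k) = k"
  and coeff_rising_poly: "Polynomial.coeff (rising_poly k) k = 1 / fact k"
  using coeff_pochhammer_X[of k] by (simp_all add: rising_poly_def)

text \<open>There is one basis polynomial in each degree, so the leading term can be peeled off; the
  factorial in \<open>c\<close> undoes the leading coefficient of
  \<open>rising_poly\<close>.\<close>

lemma rising_poly_expansion:
  assumes "Polynomial.degree p \<le> d"
  shows "\<exists>a. p = (\<Sum>k\<le>d. Polynomial.smult (a k) (rising_poly k))"
  using assms
proof (induction d arbitrary: p)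
  case 0
  then obtain c where "p = [:c:]" by (auto elim: degree_eq_zeroE)
  then show ?case by (intro exI[of _ "\<lambda>_. c"]) simp
next
  case (Suc d)
  define c where "c = Polynomial.coeff p (Suc d) * fact (Suc d)"
  define q where "q = p - Polynomial.smult c (rising_poly (Suc d))"
  have "Polynomial.coeff q (Suc d) = 0"
    by (simp add: q_def c_def coeff_rising_poly)
  moreover have "Polynomial.degree q \<le> Suc d"
    unfolding q_def using Suc.prems
    by (intro degree_diff_le order.trans[OF degree_smult_le]) (simp_all add: degree_rising_poly)
  ultimately have "Polynomial.degree q \<le> d"
    by (metis le_SucE leading_coeff_0_iff degree_0 le0)
  then obtain a where a: "q = (\<Sum>k\<le>d. Polynomial.smult (a k) (rising_poly k))" using Suc.IH by blast
  have "p = q + Polynomial.smult c (rising_poly (Suc d))" by (simp add: q_def)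
  also have "\<dots> = (\<Sum>k\<le>Suc d. Polynomial.smult ((a(Suc d := c)) k) (rising_poly k))"
    unfolding a by simp
  finally show ?case by blast
qed

lemma rising_poly_independent:
  assumes "(\<Sum>k\<le>d. Polynomial.smult (a k) (rising_poly k)) = 0" "k \<le> d"
  shows "a k = 0"
  using assms
proof (induction d)
  case (Suc d)
  have "0 = Polynomial.coeff (\<Sum>k\<le>Suc d. Polynomial.smult (a k) (rising_poly k)) (Suc d)"
    using Suc.prems by simp
  also have "\<dots> = a (Suc d) / fact (Suc d)"
    by (simp add: coeff_sum coeff_eq_0 degree_rising_poly coeff_rising_poly del: fact_Suc)
  finally have "a (Suc d) = 0" by simp
  then show ?case using Suc by (cases "k = Suc d") simp_all
qed simp

lemma poly_eq_of_eventually_eq: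
  fixes p q :: "real poly"
  assumes "\<forall>\<^sub>F n in sequentially. poly p (real n) = poly q (real n)"
  shows "p = q"
proof (rule ccontr)
  assume "p \<noteq> q"
  then have "finite {x. poly (p - q) x = 0}" by (intro poly_roots_finite) simp
  moreover obtain N where N: "\<And>n. n \<ge> N \<Longrightarrow> poly p (real n) = poly q (real n)"
    using assms by (auto simp: eventually_sequentially)
  then have "real ` {N..} \<subseteq> {x. poly (p - q) x = 0}" by auto
  ultimately have "finite (real ` {N..})" by (rule rev_finite_subset)
  then show False by (simp add: finite_image_iff infinite_Ici)
qed

lemma sum_atMost_flip: "(\<Sum>i\<le>d. f (d - i)) = (\<Sum>i\<le>(d::nat). f i)"
  by (rule sum.reindex_bij_witness[of _ "\<lambda>i. d - i" "\<lambda>i. d - i"]) auto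

text \<open>The Hilbert polynomial with coefficients \<open>e\<close>, indexed by the degree k = d -
  i of the basis polynomial instead of by i.\<close>

definition signed_rising_sum :: "nat \<Rightarrow> (nat \<Rightarrow> real) \<Rightarrow> real poly" where
  "signed_rising_sum d e = (\<Sum>k\<le>d. Polynomial.smult ((-1) ^ (d - k) * e (d - k)) (rising_poly k))"

lemma poly_signed_rising_sum:
  assumes "n \<ge> 1"
  shows "poly (signed_rising_sum d e) (real n)
    = (\<Sum>i\<le>d. (-1) ^ i * e i * real ((n + d - 1 - i) choose (d - i)))"
proof -
  have "poly (signed_rising_sum d e) (real n)
      = (\<Sum>k\<le>d. (-1) ^ (d - k) * e (d - k) * real ((n + k - 1) choose k))"
    using assms by (simp add: signed_rising_sum_def poly_sum poly_rising_poly_nat)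
  also have "\<dots> = (\<Sum>k\<le>d. (-1) ^ (d - (d - k)) * e (d - (d - k)) * real ((n + (d - k) - 1) choose (d - k)))"
    by (rule sum_atMost_flip[symmetric])
  also have "\<dots> = (\<Sum>i\<le>d. (-1) ^ i * e i * real ((n + d - 1 - i) choose (d - i)))"
    by (rule sum.cong) auto
  finally show ?thesis .
qed

lemma poly_signed_rising_sum_0: "poly (signed_rising_sum d e) 0 = (-1) ^ d * e d"
proof -
  have "poly (signed_rising_sum d e) 0 = (\<Sum>k\<le>d. if k = 0 then (-1) ^ d * e d else 0)"
    unfolding signed_rising_sum_def poly_sum
    by (rule sum.cong) (auto simp: poly_rising_poly pochhammer_0_left)
  then show ?thesis by simp
qed

text \<open>
  Replacing an ideal by its \<open>s\<close>-th power substitutes \<open>s x\<close> into the Hilbert polynomial, so the value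
  at \<open>0\<close>, which is the last coefficient up to sign, does not change.
\<close>

lemma tight_hilbert_coeff_top:
  assumes len: "\<And>n. n \<ge> 1 \<Longrightarrow>
      quotient_length R (tight_closure R p (J [^]\<^bsub>ideals_set R\<^esub> n)) = enat (L (s * n))"
    and L: "\<And>k. k \<ge> 1 \<Longrightarrow> real (L k) = (\<Sum>i\<le>d. (-1) ^ i * c i * real ((k + d - 1 - i) choose (d - i)))"
    and s: "s \<ge> 1"
  shows "tight_hilbert_coeff R p d J d = c d"
proof -
  define P where "P = pcompose (signed_rising_sum d c) [:0, real s:]"
  have deg: "Polynomial.degree P \<le> d"
  proof -
    have "Polynomial.degree (signed_rising_sum d c) \<le> d"
      unfolding signed_rising_sum_def
      by (intro degree_sum_le order.trans[OF degree_smult_le]) (auto simp: degree_rising_poly)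
    then show ?thesis using s by (simp add: P_def degree_pcompose)
  qed
  have P: "real (L (s * n)) = poly P (real n)" if "n \<ge> 1" for n
    using L[of "s * n"] poly_signed_rising_sum[of "s * n" d c] that s
    by (simp add: P_def poly_pcompose mult.commute)
  obtain a where a: "P = (\<Sum>k\<le>d. Polynomial.smult (a k) (rising_poly k))"
    using rising_poly_expansion[OF deg] by blast
  \<comment> \<open>The value 0 beyond \<open>d\<close> is the normalization under which the
    coefficient sequence is unique.\<close>
  define e where "e i = (if i \<le> d then (-1) ^ i * a (d - i) else 0)" for i
  have Pe: "P = signed_rising_sum d e"
    unfolding a signed_rising_sum_def by (rule sum.cong) (auto simp: e_def)
  \<comment> \<open>Two polynomials that agree at all large integers are equal, so the asymptotic
    condition becomes a polynomial identity.\<close>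
  have spec: "(\<forall>\<^sub>F n in sequentially.
      ereal_of_enat (quotient_length R (tight_closure R p (J [^]\<^bsub>ideals_set R\<^esub> n))) =
      ereal (\<Sum>i\<le>d. (-1) ^ i * e' i * real ((n + d - 1 - i) choose (d - i)))) \<longleftrightarrow>
      signed_rising_sum d e' = P" (is "eventually ?Q _ \<longleftrightarrow> _") for e'
  proof -
    have "?Q n \<longleftrightarrow> poly (signed_rising_sum d e') (real n) = poly P (real n)" if "n \<ge> 1" for n
      using that by (simp add: len P poly_signed_rising_sum eq_commute)
    then have "\<forall>\<^sub>F n in sequentially. ?Q n \<longleftrightarrow> poly (signed_rising_sum d e') (real n) = poly P (real n)"
      using eventually_ge_at_top[of "1::nat"] by (rule eventually_mono[rotated])
    then have "eventually ?Q sequentially \<longleftrightarrow>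
        (\<forall>\<^sub>F n in sequentially. poly (signed_rising_sum d e') (real n) = poly P (real n))"
      by (rule eventually_subst)
    then show ?thesis using poly_eq_of_eventually_eq by auto
  qed
  have "(THE e'. (\<forall>i>d. e' i = 0) \<and> signed_rising_sum d e' = P) = e"
  proof (rule the_equality)
    show "(\<forall>i>d. e i = 0) \<and> signed_rising_sum d e = P" using Pe by (simp add: e_def)
    fix e' assume e': "(\<forall>i>d. e' i = 0) \<and> signed_rising_sum d e' = P"
    show "e' = e"
    proof
      fix i
      show "e' i = e i"
      proof (cases "i \<le> d")
        case True
        have "(\<Sum>k\<le>d. Polynomial.smult ((-1) ^ (d - k) * e' (d - k) - (-1) ^ (d - k) * e (d - k)) (rising_poly k)) = 0"
          using e' Pe by (simp add: signed_rising_sum_def smult_diff_left sum_subtractf)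
        then have "(-1) ^ (d - (d - i)) * e' (d - (d - i)) - (-1) ^ (d - (d - i)) * e (d - (d - i)) = 0"
          by (rule rising_poly_independent) simp
        then show ?thesis using True by (simp flip: right_diff_distrib)
      qed (use e' in \<open>simp add: e_def\<close>)
    qed
  qed
  then have "tight_hilbert_coeff R p d J d = e d"
    unfolding tight_hilbert_coeff_def spec by simp
  \<comment> \<open>Both sides are compared at 0, which the substitution of s x for x leaves
    fixed.\<close>
  also have "(-1) ^ d * e d = poly (signed_rising_sum d c) 0"
    using poly_signed_rising_sum_0[of d e] by (simp flip: Pe) (simp add: P_def poly_pcompose)
  then have "e d = c d" by (simp add: poly_signed_rising_sum_0)
  finally show ?thesis .
qed

theorem theorem6p2:
  fixes R :: "'k::field mpoly set ring"
    and \<Delta> :: "nat set set"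
    and v d p g n :: nat
    and \<mm> :: "'k mpoly set set"
    and I :: "nat \<Rightarrow> 'k mpoly set set"
    and s :: "nat \<Rightarrow> nat"
    and h :: "real poly"
  assumes "simplicial_complex v \<Delta>"
    and "complex_dim \<Delta> = int d - 1"
    and "prime p" and "CHAR('k) = p"
    and "R = stanley_reisner_ring v \<Delta>"
    and "maximal_homogeneous_ideal \<mm> R (sr_component v \<Delta>)"
    and "\<forall>i\<in>{1..g}. \<exists>\<theta>. linear_sop R (sr_component v \<Delta>) \<theta> \<and> I i = Idl\<^bsub>R\<^esub> (set \<theta>)"
    and "h = h_polynomial R (sr_scalars v \<Delta>) (sr_component v \<Delta>) d"
    and "\<forall>i\<in>{1..g}. s i > 0"
    and "(\<Sum>i=1..g. s i) = n + 1"
  shows "quotient_length R (tight_closure R p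
             (\<Otimes>\<^bsub>ideals_set R\<^esub>i\<in>{1..g}. I i [^]\<^bsub>ideals_set R\<^esub> s i)) =
           quotient_length R (\<mm> [^]\<^bsub>ideals_set R\<^esub> (n + 1))
       \<and> ereal_of_enat (quotient_length R (\<mm> [^]\<^bsub>ideals_set R\<^esub> (n + 1))) =
           ereal (\<Sum>i=0..d. (-1) ^ i * (poly ((pderiv ^^ i) h) 1 / fact i) *
             real ((n + d - i) choose (d - i)))
       \<and> tight_hilbert_coeff R p d
             (\<Otimes>\<^bsub>ideals_set R\<^esub>i\<in>{1..g}. I i [^]\<^bsub>ideals_set R\<^esub> s i) d =
           Polynomial.coeff h d"
proof -
  interpret stanley_reisner v \<Delta> R
    by unfold_locales (fact assms(1), fact assms(5))
  let ?J = "\<Otimes>\<^bsub>ideals_set R\<^esub>i\<in>{1..g}. I i [^]\<^bsub>ideals_set R\<^esub> s i"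
  define c where "c j = real (card (face_monomials \<Delta> j))" for j
  define L where "L k = card {m. supp m \<in> \<Delta> \<and> mdeg m < k}" for k
  have p: "p \<ge> 2" using assms(3) by (rule prime_ge_2_nat)
  have \<mm>: "\<mm> [^]\<^bsub>ideals_set R\<^esub> (n + 1) = D (n + 1)"
    unfolding maximal_homogeneous_ideal_eq[OF assms(6)] D_pow_ideal by simp
  have "facewise_full (s i * 1) (I i [^]\<^bsub>ideals_set R\<^esub> s i)" if i: "i \<in> {1..g}" for i
  proof (rule facewise_full_pow)
    obtain \<theta> where "linear_sop R (sr_component v \<Delta>) \<theta>" "I i = Idl\<^bsub>R\<^esub> (set \<theta>)"
      using assms(7) i by blast
    then show "facewise_full 1 (I i)" using facewise_full_linear_sop by simp
  qed
  then have "facewise_full (\<Sum>i\<in>{1..g}. s i * 1) ?J"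
    by (intro facewise_full_finprod finite_atLeastAtMost)
  then have J: "facewise_full (n + 1) ?J" using assms(10) by simp
  have len: "quotient_length R (D k) = enat (L k)" for k
    by (simp only: quotient_length_D L_def)
  have tc: "tight_closure R p ?J = D (n + 1)"
    by (rule tight_closure_facewise_full[OF p J])
  \<comment> \<open>The N-th power of \<open>?J\<close> is facewise full with exponent N (n + 1), so
    \<open>?J\<close> behaves like the (n + 1)-st power of \<mm>.\<close>
  have tc_pow: "tight_closure R p (?J [^]\<^bsub>ideals_set R\<^esub> N) = D ((n + 1) * N)" for N :: nat
    using tight_closure_facewise_full[OF p facewise_full_pow[OF J, of N]] by (simp only: mult.commute)
  have card_le: "finite F \<and> card F \<le> d" if F: "F \<in> \<Delta>" for F
  proof
    show "finite F" by (rule finite_face[OF F])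
    have "int (card F) - 1 \<le> complex_dim \<Delta>"
      unfolding complex_dim_def using F finite_complex by (intro Max_ge) auto
    then show "card F \<le> d" using assms(2) by simp
  qed
  have deg: "Polynomial.degree (face_polynomial d \<Delta>) \<le> d"
    using finite_complex card_le by (intro degree_face_polynomial) auto
  have series: "Abs_fps c * (1 - fps_X) ^ d = fps_of_poly (face_polynomial d \<Delta>)"
    unfolding c_def[abs_def] using finite_complex card_le by (rule hilbert_series_complex)
  have "hilbert_series R (sr_scalars v \<Delta>) (sr_component v \<Delta>) = Abs_fps c"
    by (simp add: hilbert_series_def c_def[abs_def] dim_sr_component)
  then have h: "h = face_polynomial d \<Delta>"
    unfolding assms(8) using series deg by (intro h_polynomial_eqI) simp_all
  \<comment> \<open>\<open>L\<close> counts degrees strictly below its argument, so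
    \<open>Suc k\<close> corresponds to the sum of the Hilbert function up to
    \<open>k\<close>.\<close>
  have L_Suc: "real (L (Suc k)) = (\<Sum>i\<le>d. (-1) ^ i * taylor_coeff h i * real ((k + d - i) choose (d - i)))" for k
    using sum_hilbert_function[OF series deg, of k]
    unfolding L_def card_face_monomials_less h
    by (simp add: c_def lessThan_Suc_atMost)
  have "tight_hilbert_coeff R p d ?J d = taylor_coeff h d"
  proof (rule tight_hilbert_coeff_top[where L = L and s = "n + 1"])
    show "quotient_length R (tight_closure R p (?J [^]\<^bsub>ideals_set R\<^esub> N)) = enat (L ((n + 1) * N))" for N
      by (simp only: tc_pow len)
    \<comment> \<open>The tight Hilbert polynomial is normalized with n + d - 1 - i, hence the shift
      by one.\<close>
    show "real (L k) = (\<Sum>i\<le>d. (-1) ^ i * taylor_coeff h i * real ((k + d - 1 - i) choose (d - i)))"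
      if "k \<ge> 1" for k
      using that L_Suc[of "k - 1"] by simp
  qed simp
  then have "tight_hilbert_coeff R p d ?J d = Polynomial.coeff h d"
    using taylor_coeff_top[OF deg] by (simp only: h)
  moreover have "ereal_of_enat (quotient_length R (D (n + 1))) =
      ereal (\<Sum>i=0..d. (-1) ^ i * (poly ((pderiv ^^ i) h) 1 / fact i) * real ((n + d - i) choose (d - i)))"
    using L_Suc[of n] by (simp add: len taylor_coeff_def atLeast0AtMost)
  ultimately show ?thesis unfolding tc \<mm> by blast
qed

end
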